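(* Suppose that $\boldsymbol\xi\sim P$ satisfies density-level regular variation with index $s$ and the second-order assumption with exponent $\gamma>0$, that $(L_1,\dots,L_K)\in\mathcal H_1$ is regular, and that $\mathcal J\in\mathfrak J$ is a nonempty subset of $[K]$ under consideration. Suppose further that for some $m,\ell\in(0,1/2]$, $|\widehat s_{t_n}-s|=O_P(k_n^{-m})$ and $\|\widehat\varphi^{(t_n)}-\varphi^{(t_n)}\|_\infty=O_P(k_n^{-\ell})$. Finally assume local identifiability: with $V_n=\sup_{\boldsymbol z\in\Gamma_{u_n}(\mathcal J)}\Psi_n(\boldsymbol z)$, there exist constants $c>0$, $\kappa\ge1$, $\delta_0>0$ such that for all sufficiently large $n$, $$V_n-\Psi_n(\boldsymbol z)\ge c\,\{d(\boldsymbol z,Y_n)\wedge\delta_0\}^\kappa,\qquad\boldsymbol z\in\Gamma_{u_n}(\mathcal J)\cap\mathcal K_{\mathcal J},$$ where $\mathcal K_{\mathcal J}\subset\mathcal E\setminus\{\boldsymbol0\}$ is the compact localization set. Then, with $$a_n=k_n^{-\ell}+k_n^{-m}\log(u_n/t_n)+t_n^{-\gamma},$$ one has $$\sup_{\widehat{\boldsymbol z}\in\widehat Y_n}d(\widehat{\boldsymbol z},Y_n)=O_P\big(a_n^{1/\kappa}\big).$$ In particular, if $Y_n=\{\boldsymbol z_n^\star\}$ is a singleton, then every $\widehat{\boldsymbol z}_n\in\widehat Y_n$ satisfies $\|\widehat{\boldsymbol z}_n-\boldsymbol z_n^\star\|=O_P(a_n^{1/\kappa})$.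
   Context: Setting. $\|\cdot\|$ is the Euclidean norm on $\mathbb R^d$, $d(\boldsymbol z,A)$ the Euclidean distance from a point to a set; $\mathcal E\subset\mathbb R^d$ is a closed cone; $\Theta_{\mathcal E}=\{\boldsymbol z\in\mathcal E:\|\boldsymbol z\|=1\}$; $B_r=\{\boldsymbol z:\|\boldsymbol z\|\le r\}$; $d\boldsymbol\phi$ is surface measure on $\Theta_{\mathcal E}$. $\boldsymbol\xi\sim P$ has density $f_P=f_{\boldsymbol\xi}$ supported on $\mathcal E$; $R=\|\boldsymbol\xi\|$, $\boldsymbol\Phi=\boldsymbol\xi/\|\boldsymbol\xi\|$. $[K]=\{1,\dots,K\}$. Density-level regular variation: $f_{\boldsymbol\xi}$ is continuous on $B_{r_0}^c\cap\mathcal E$ for some $r_0>0$, and there are $s>0$ and $\varphi^\star:\mathcal E\setminus\{\boldsymbol 0\}\to(0,\infty)$ with $t^{s+d}f_{\boldsymbol\xi}(t\boldsymbol z)\to\varphi^\star(\boldsymbol z)$ as $t\to\infty$, uniformly over compact subsets of $\mathcal E\setminus\{\boldsymbol 0\}$. Second-order assumption: moreover there is $\gamma>0$ with $\sup_{r>t,\ \boldsymbol\phi\in\Theta_{\mathcal E}}|r^{s+d}f_{\boldsymbol\xi}(r\boldsymbol\phi)-\varphi^\star(\boldsymbol\phi)|=O(t^{-\gamma})$ as $t\to\infty$. Loss systems: measurable functions $L_1,\dots,L_K:\mathcal E\to\mathbb R$ form an asymptotically homogeneous multi-loss system, $(L_1,\dots,L_K)\in\mathcal H_1$, if for each $j$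 there is $L_j^\star:\mathcal E\to\mathbb R$ with $\{L_j^\star>0\}\ne\varnothing$ and $t^{-1}L_j(t\boldsymbol z_t)\to L_j^\star(\boldsymbol z)$ whenever $t\to\infty$ and $\boldsymbol z_t\to\boldsymbol z$ in $\mathcal E$. $\mathcal S(u;\mathcal J)=\{\boldsymbol z\in\mathcal E:L_j(\boldsymbol z)\ge u\ \forall j\in\mathcal J\}$, $\Gamma_u(\mathcal J)=u^{-1}\mathcal S(u;\mathcal J)$, $\mathcal S^\star(\mathcal J)=\{\boldsymbol z\in\mathcal E:L_j^\star(\boldsymbol z)\ge1\ \forall j\in\mathcal J\}$. $\mathfrak J$ is the collection of nonempty subsets of $[K]$ under consideration; the system is regular if $\mathcal S^\star(\mathcal J)$ has nonzero Lebesgue measure for every $\mathcal J\in\mathfrak J$. Data and thresholds: $\boldsymbol\xi_1,\dots,\boldsymbol\xi_n$ are i.i.d. from $P$, $R_i=\|\boldsymbol\xi_i\|$, $R_{(k)}$ is the $k$th largest of $R_1,\dots,R_n$. Fix $q\in(0,1)$, $k_n=\lfloor n^{1-q}\rfloor$, $t_n=R_{(k_n)}$. Fix $r\ge1$ and let $u_n$ be the $(1-n^{-r})$-quantile of $R$ under $P$. $\varphi^{(t)}$ is the conditional density (w.r.t. $d\boldsymbol\phi$) of $\boldsymbol\Phi$ given $\{R>t\}$, namely $\varphi^{(t)}(\boldsymbol\phi)=\mathbb P(R>t)^{-1}\int_t^\infty r^{d-1}f_{\boldsymbol\xi}(r\boldsymbol\phi)\,dr$. $\widehat s_{t_n}>0$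 and the probability density $\widehat\varphi^{(t_n)}$ on $\Theta_{\mathcal E}$ are estimators built from observations with $R_i\ge t_n$; $\|\cdot\|_\infty$ is the sup norm on $\Theta_{\mathcal E}$. Data-driven SSGEN law $\widehat P_{\rm gen}^{(t_n)}$: on $\{\|\boldsymbol x\|>t_n\}$ it has Cartesian density $f_{\widehat P_{\rm gen}^{(t_n)}}(\rho\boldsymbol\phi)=\rho^{-(d-1)}\,\frac{k_n}{n}\,\widehat s_{t_n}\,t_n^{\widehat s_{t_n}}\,\rho^{-(\widehat s_{t_n}+1)}\,\widehat\varphi^{(t_n)}(\boldsymbol\phi)$ ($\rho>t_n$, $\boldsymbol\phi\in\Theta_{\mathcal E}$); the remaining mass (the body) is carried by $\{\|\boldsymbol x\|\le t_n\}$ (with probability tending to one $\mathcal S(u_n;\mathcal J)\subset\{\|\boldsymbol x\|>t_n\}$, so the body is immaterial). Reverse-stress problems: $\Psi_n(\boldsymbol z)=u_n^{s+d}f_P(u_n\boldsymbol z)$, $\widehat\Psi_n(\boldsymbol z)=u_n^{s+d}f_{\widehat P_{\rm gen}^{(t_n)}}(u_n\boldsymbol z)$, $Y_n=\arg\max_{\Gamma_{u_n}(\mathcal J)}\Psi_n$, $\widehat Y_n=\arg\max_{\Gamma_{u_n}(\mathcal J)}\widehat\Psi_n$ (full maximizer sets). It is assumed that these maxima are attained (for all large $n$). Localization set: $\mathcal K_{\mathcal J}$ is a compact subset of $\mathcal E\setminus\{\boldsymbol0\}$ with $Y_n\subseteq\mathcal K_{\mathcal J}$ for all sufficiently large $n$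 and $\mathbb P(\widehat Y_n\subseteq\mathcal K_{\mathcal J})\to1$ (such a set exists under the hypotheses other than local identifiability). *)

theory Defs
  imports "HOL-Probability.Probability"
begin

section \<open>Convergence in outer probability\<close>

text \<open>Suprema over uncountable sets and maximizer sets need not be measurable, so stochastic
  orders are stated with the outer probability; on measurable events it is the probability.\<close>

definition with_prob_tending_to_one :: "'w measure \<Rightarrow> (nat \<Rightarrow> 'w \<Rightarrow> bool) \<Rightarrow> bool" where
  "with_prob_tending_to_one M Q \<longleftrightarrow>
     (\<lambda>n. outer_measure_of M {\<omega> \<in> space M. \<not> Q n \<omega>}) \<longlonglongrightarrow> 0"

text \<open>\<^term>\<open>big_O_P M X a\<close> reads $X_n = O_P(a_n)$ for $X_n \ge 0$, possibly infinite, and a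
  possibly random rate $a_n$.\<close>

definition big_O_P :: "'w measure \<Rightarrow> (nat \<Rightarrow> 'w \<Rightarrow> ennreal) \<Rightarrow> (nat \<Rightarrow> 'w \<Rightarrow> real) \<Rightarrow> bool" where
  "big_O_P M X a \<longleftrightarrow>
     (\<forall>\<epsilon>>0. \<exists>C>0. \<forall>\<^sub>F n in sequentially.
        outer_measure_of M {\<omega> \<in> space M. X n \<omega> > ennreal (C * a n \<omega>)} \<le> ennreal \<epsilon>)"


section \<open>Order statistics, exceedances and quantiles\<close>

definition kth_largest :: "nat \<Rightarrow> real list \<Rightarrow> real" where
  "kth_largest k xs = rev (sort xs) ! (k - 1)"

text \<open>The sample of size \<open>n\<close> is indexed by \<open>0, \<dots>, n - 1\<close>.\<close>

definition radii :: "(nat \<Rightarrow> 'w \<Rightarrow> 'a::real_normed_vector) \<Rightarrow> nat \<Rightarrow> 'w \<Rightarrow> real list" where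
  "radii \<xi> n \<omega> = map (\<lambda>i. norm (\<xi> i \<omega>)) [0..<n]"

definition exceedances ::
    "(nat \<Rightarrow> 'w \<Rightarrow> 'a::real_normed_vector) \<Rightarrow> nat \<Rightarrow> real \<Rightarrow> 'w \<Rightarrow> 'a list" where
  "exceedances \<xi> n t \<omega> = filter (\<lambda>x. norm x \<ge> t) (map (\<lambda>i. \<xi> i \<omega>) [0..<n])"

definition quantile :: "real measure \<Rightarrow> real \<Rightarrow> real" where
  "quantile D p = Inf {x. p \<le> cdf D x}"


section \<open>Polar coordinates on the cone\<close>

definition unit_dirs :: "'a::real_normed_vector set \<Rightarrow> 'a set" where
  "unit_dirs E = {z \<in> E. norm z = 1}"

text \<open>The surface measure of a Borel subset \<open>A\<close> of the unit sphere is the dimension times the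
  Lebesgue measure of the truncated cone of all \<open>r *\<^sub>R a\<close> with \<open>0 < r \<le> 1\<close> and \<open>a \<in> A\<close>.\<close>

definition surface_measure :: "'a::euclidean_space measure" where
  "surface_measure = scale_measure (ennreal (real DIM('a)))
     (distr (restrict_space lborel (cball 0 1 - {0})) (restrict_space borel (sphere 0 1))
        (\<lambda>x. x /\<^sub>R norm x))"

definition angular_prob_density :: "'a::euclidean_space set \<Rightarrow> ('a \<Rightarrow> real) \<Rightarrow> bool" where
  "angular_prob_density E \<phi> \<longleftrightarrow>
     \<phi> \<in> borel_measurable (restrict_space borel (unit_dirs E)) \<and>
     (\<forall>\<theta>\<in>unit_dirs E. 0 \<le> \<phi> \<theta>) \<and>
     (\<integral>\<^sup>+\<theta>\<in>unit_dirs E. ennreal (\<phi> \<theta>) \<partial>surface_measure) = 1"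

definition law_of_density :: "('a::euclidean_space \<Rightarrow> real) \<Rightarrow> 'a measure" where
  "law_of_density f = density lborel (\<lambda>z. ennreal (f z))"

definition cond_angular_density :: "('a::euclidean_space \<Rightarrow> real) \<Rightarrow> real \<Rightarrow> 'a \<Rightarrow> real" where
  "cond_angular_density f t \<theta> =
     (LINT r:{t<..}|lborel. r ^ (DIM('a) - 1) * f (r *\<^sub>R \<theta>))
       / measure (law_of_density f) {z. norm z > t}"

definition angular_sup_norm :: "'a::real_normed_vector set \<Rightarrow> ('a \<Rightarrow> real) \<Rightarrow> ennreal" where
  "angular_sup_norm E g = (SUP \<theta>\<in>unit_dirs E. ennreal \<bar>g \<theta>\<bar>)"


section \<open>Regular variation of densities\<close>

definition density_on_cone :: "'a::euclidean_space set \<Rightarrow> ('a \<Rightarrow> real) \<Rightarrow> bool" where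
  "density_on_cone E f \<longleftrightarrow>
     f \<in> borel_measurable borel \<and> (\<forall>z. 0 \<le> f z) \<and> (\<forall>z. z \<notin> E \<longrightarrow> f z = 0) \<and>
     prob_space (law_of_density f)"

definition density_regularly_varying ::
    "'a::euclidean_space set \<Rightarrow> ('a \<Rightarrow> real) \<Rightarrow> real \<Rightarrow> ('a \<Rightarrow> real) \<Rightarrow> bool" where
  "density_regularly_varying E f s \<phi>star \<longleftrightarrow>
     s > 0 \<and>
     (\<exists>r\<^sub>0>0. continuous_on (E - cball 0 r\<^sub>0) f) \<and>
     (\<forall>z\<in>E - {0}. \<phi>star z > 0) \<and>
     (\<forall>C. compact C \<and> C \<subseteq> E - {0} \<longrightarrow>
        uniform_limit C (\<lambda>t z. t powr (s + real DIM('a)) * f (t *\<^sub>R z)) \<phi>star at_top)"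

definition second_order_condition ::
    "'a::euclidean_space set \<Rightarrow> ('a \<Rightarrow> real) \<Rightarrow> real \<Rightarrow> ('a \<Rightarrow> real) \<Rightarrow> real \<Rightarrow> bool" where
  "second_order_condition E f s \<phi>star \<gamma> \<longleftrightarrow>
     \<gamma> > 0 \<and>
     (\<exists>C. \<forall>\<^sub>F t in at_top. \<forall>r>t. \<forall>\<theta>\<in>unit_dirs E.
        \<bar>r powr (s + real DIM('a)) * f (r *\<^sub>R \<theta>) - \<phi>star \<theta>\<bar> \<le> C * t powr (- \<gamma>))"


section \<open>Multi-loss systems\<close>

definition asymp_homogeneous_system ::
    "'a::euclidean_space set \<Rightarrow> nat \<Rightarrow> (nat \<Rightarrow> 'a \<Rightarrow> real) \<Rightarrow> (nat \<Rightarrow> 'a \<Rightarrow> real) \<Rightarrow> bool" where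
  "asymp_homogeneous_system E K L Lstar \<longleftrightarrow>
     (\<forall>j\<in>{1..K}.
        L j \<in> borel_measurable (restrict_space borel E) \<and>
        (\<exists>z\<in>E. Lstar j z > 0) \<and>
        (\<forall>z\<in>E. \<forall>w :: real \<Rightarrow> 'a. (\<forall>t. w t \<in> E) \<and> (w \<longlongrightarrow> z) at_top \<longrightarrow>
           ((\<lambda>t. L j (t *\<^sub>R w t) / t) \<longlongrightarrow> Lstar j z) at_top))"

definition stress_set :: "'a set \<Rightarrow> (nat \<Rightarrow> 'a \<Rightarrow> real) \<Rightarrow> real \<Rightarrow> nat set \<Rightarrow> 'a set" where
  "stress_set E L u J = {z \<in> E. \<forall>j\<in>J. L j z \<ge> u}"

definition scaled_stress_set ::
    "'a::real_vector set \<Rightarrow> (nat \<Rightarrow> 'a \<Rightarrow> real) \<Rightarrow> real \<Rightarrow> nat set \<Rightarrow> 'a set" where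
  "scaled_stress_set E L u J = (\<lambda>z. z /\<^sub>R u) ` stress_set E L u J"

text \<open>The limiting set is \<^term>\<open>stress_set E Lstar 1 J\<close>.\<close>

definition regular_system ::
    "'a::euclidean_space set \<Rightarrow> (nat \<Rightarrow> 'a \<Rightarrow> real) \<Rightarrow> nat set set \<Rightarrow> bool" where
  "regular_system E Lstar JJ \<longleftrightarrow> (\<forall>J\<in>JJ. emeasure lebesgue (stress_set E Lstar 1 J) \<noteq> 0)"

definition argmax_set :: "('a \<Rightarrow> real) \<Rightarrow> 'a set \<Rightarrow> 'a set" where
  "argmax_set g A = {z. is_arg_max g (\<lambda>z. z \<in> A) z}"


section \<open>The data-driven generative law\<close>

text \<open>\<open>Q\<close> is a probability law which on \<open>{x. norm x > t}\<close> has the Cartesian density \<open>g\<close> given by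
  tail mass \<open>p\<close>, Pareto index \<open>s\<close> and angular density \<open>\<phi>\<close>. The remaining mass lies in
  \<open>{x. norm x \<le> t}\<close> since \<open>Q\<close> is a probability; the body of \<open>Q\<close>, which may be singular, and the
  values of \<open>g\<close> there are unconstrained.\<close>

definition ssgen_law ::
    "'a::euclidean_space set \<Rightarrow> real \<Rightarrow> real \<Rightarrow> real \<Rightarrow> ('a \<Rightarrow> real) \<Rightarrow> 'a measure \<Rightarrow> ('a \<Rightarrow> real) \<Rightarrow> bool"
  where
  "ssgen_law E t p s \<phi> Q g \<longleftrightarrow>
     prob_space Q \<and> sets Q = sets borel \<and>
     (\<forall>A\<in>sets borel. A \<subseteq> {x. norm x > t} \<longrightarrow> emeasure Q A = (\<integral>\<^sup>+x\<in>A. ennreal (g x) \<partial>lborel)) \<and>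
     (\<forall>x. norm x > t \<and> x \<notin> E \<longrightarrow> g x = 0) \<and>
     (\<forall>\<rho>>t. \<forall>\<theta>\<in>unit_dirs E.
        g (\<rho> *\<^sub>R \<theta>) =
          \<rho> powr (- (real DIM('a) - 1)) * p * s * t powr s * \<rho> powr (- (s + 1)) * \<phi> \<theta>)"

end

(* Maximizer sets do not change when the objective is multiplied by a positive constant. Hence the
   factor k_n / n and the power (u_n / t_n)^(s - s_hat) in the estimated objective can be dropped,
   and the estimated objective may be replaced by
   H z = |z|^-(s_hat + d) * s * t_n^s * P(R > t_n) * phi_hat (z / |z|).
   Integrating the second-order condition along rays gives
   s * t^s * P(R > t) * phi^(t) = phi_star + O(t^-gamma) uniformly in the direction, so on the
   localization set H is within O(k_n^-l + k_n^-m + t_n^-gamma) of Psi_n. Comparing a maximizer of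
   Psi_n with one of H bounds the optimality gap of the latter by twice this distance, and local
   identifiability turns the gap into a distance; the truncation at delta_0 costs only a constant
   because the localization set is bounded. The logarithm in a_n is at least one with probability
   tending to one: P(R > u_n) <= n^-r with r >= 1 forces u_n to be at least of order n^(r/s),
   whereas Markov's inequality for the number of exceedances keeps t_n below any fixed multiple of
   n^(r/s). *)
theory Submission
  imports Defs "HOL-Real_Asymp.Real_Asymp"
begin

section \<open>Tails of regularly varying densities\<close>

lemma nn_integral_lborel_scaleR:
  fixes h :: "'a::euclidean_space \<Rightarrow> ennreal"
  assumes [measurable]: "h \<in> borel_measurable borel" and t: "0 < t"
  shows "(\<integral>\<^sup>+z. h z \<partial>lborel) = ennreal (t ^ DIM('a)) * (\<integral>\<^sup>+z. h (t *\<^sub>R z) \<partial>lborel)"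
proof -
  have "(\<integral>\<^sup>+z. h z \<partial>lborel) =
      (\<integral>\<^sup>+z. h z \<partial>density (distr lborel borel (\<lambda>x::'a. 0 + t *\<^sub>R x)) (\<lambda>_. \<bar>t\<bar> ^ DIM('a)))"
    using lborel_affine[of t "0::'a"] t by simp
  also have "\<dots> = (\<integral>\<^sup>+z. ennreal (t ^ DIM('a)) * h (t *\<^sub>R z) \<partial>lborel)"
    using t by (subst nn_integral_density) (simp_all add: nn_integral_distr)
  finally show ?thesis
    by (simp add: nn_integral_cmult)
qed

lemma emeasure_law_of_density:
  assumes "density_on_cone E f" "A \<in> sets borel"
  shows "emeasure (law_of_density f) A = (\<integral>\<^sup>+z\<in>A. ennreal (f z) \<partial>lborel)"
  using assms unfolding law_of_density_def density_on_cone_def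
  by (subst emeasure_density) auto

text \<open>Substituting \<open>t *\<^sub>R z\<close> for \<open>z\<close> preserves the cone. The
  Jacobian t^d meets an integrand homogeneous of degree -(s + d), which leaves t^-s. Working in
  \<open>ennreal\<close> allows the identity before either side is known to be finite.\<close>

lemma cone_power_tail_integral:
  fixes E :: "'a::euclidean_space set"
  assumes E: "closed E" "cone E" and t: "0 < t"
  shows "(\<integral>\<^sup>+z\<in>E \<inter> {z. t < norm z}. ennreal (norm z powr - (s + real DIM('a))) \<partial>lborel) =
    ennreal (t powr - s) * (\<integral>\<^sup>+z\<in>E \<inter> {z. 1 < norm z}. ennreal (norm z powr - (s + real DIM('a))) \<partial>lborel)"
proof -
  have [measurable]: "E \<in> sets borel" using E by simp
  have mem: "t *\<^sub>R z \<in> E \<longleftrightarrow> z \<in> E" for z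
    using mem_cone[OF E(2), of z t] mem_cone[OF E(2), of "t *\<^sub>R z" "1/t"] t by auto
  have "(\<integral>\<^sup>+z\<in>E \<inter> {z. t < norm z}. ennreal (norm z powr - (s + real DIM('a))) \<partial>lborel) =
    ennreal (t ^ DIM('a)) * (\<integral>\<^sup>+z. ennreal (norm (t *\<^sub>R z) powr - (s + real DIM('a))) * indicator (E \<inter> {z. t < norm z}) (t *\<^sub>R z) \<partial>lborel)"
    using t by (subst nn_integral_lborel_scaleR[of _ t]) measurable
  also have "(\<integral>\<^sup>+z. ennreal (norm (t *\<^sub>R z) powr - (s + real DIM('a))) * indicator (E \<inter> {z. t < norm z}) (t *\<^sub>R z) \<partial>lborel)
    = (\<integral>\<^sup>+z. ennreal (t powr - (s + real DIM('a))) * (ennreal (norm z powr - (s + real DIM('a))) * indicator (E \<inter> {z. 1 < norm z}) z) \<partial>lborel)"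
    using t by (intro nn_integral_cong) (auto simp: indicator_def mem powr_mult ennreal_mult)
  also have "\<dots> = ennreal (t powr - (s + real DIM('a))) * (\<integral>\<^sup>+z\<in>E \<inter> {z. 1 < norm z}. ennreal (norm z powr - (s + real DIM('a))) \<partial>lborel)"
    by (subst nn_integral_cmult) simp_all
  also have "ennreal (t ^ DIM('a)) * (ennreal (t powr - (s + real DIM('a))) * (\<integral>\<^sup>+z\<in>E \<inter> {z. 1 < norm z}. ennreal (norm z powr - (s + real DIM('a))) \<partial>lborel))
     = ennreal (t ^ DIM('a) * t powr - (s + real DIM('a))) * (\<integral>\<^sup>+z\<in>E \<inter> {z. 1 < norm z}. ennreal (norm z powr - (s + real DIM('a))) \<partial>lborel)"
    using t by (simp add: ennreal_mult mult.assoc)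
  also have "t ^ DIM('a) * t powr - (s + real DIM('a)) = t powr - s"
    using t by (simp flip: powr_realpow powr_add)
  finally show ?thesis .
qed

text \<open>Integrability of \<open>\<bar>z\<bar> powr - (s + d)\<close> over the tail of the cone is not computed: it
  follows from the lower bound on \<open>f\<close>, whose integral is at most one.\<close>

lemma tail_prob_bounds:
  fixes E :: "'a::euclidean_space set"
  assumes E: "closed E" "cone E" and f: "density_on_cone E f"
    and T: "0 < T" and b: "0 < b\<^sub>1"
    and lo: "\<And>z. z \<in> E \<Longrightarrow> T < norm z \<Longrightarrow> b\<^sub>1 * norm z powr - (s + real DIM('a)) \<le> f z"
    and up: "\<And>z. z \<in> E \<Longrightarrow> T < norm z \<Longrightarrow> f z \<le> b\<^sub>2 * norm z powr - (s + real DIM('a))"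
  obtains c\<^sub>1 c\<^sub>2 where "0 < c\<^sub>1" "0 < c\<^sub>2"
    "\<And>t. T \<le> t \<Longrightarrow> c\<^sub>1 * t powr - s \<le> measure (law_of_density f) {z. t < norm z}"
    "\<And>t. T \<le> t \<Longrightarrow> measure (law_of_density f) {z. t < norm z} \<le> c\<^sub>2 * t powr - s"
proof -
  interpret P: prob_space "law_of_density f" using f by (simp add: density_on_cone_def)
  have [measurable]: "E \<in> sets borel" "f \<in> borel_measurable borel"
    and f0: "\<And>z. 0 \<le> f z" "\<And>z. z \<notin> E \<Longrightarrow> f z = 0"
    using E f by (auto simp: density_on_cone_def)
  define g where "g = (\<lambda>z::'a. norm z powr - (s + real DIM('a)))"
  have [measurable]: "g \<in> borel_measurable borel" unfolding g_def by measurable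
  \<comment> \<open>By scaling, every tail integral of \<open>g\<close> is a power of
    \<open>t\<close> times this one constant, so both bounds reduce to showing that \<open>G\<close>
    is finite and nonzero.\<close>
  define G where "G = (\<integral>\<^sup>+z\<in>E \<inter> {z. 1 < norm z}. ennreal (g z) \<partial>lborel)"
  have scale: "(\<integral>\<^sup>+z\<in>E \<inter> {z. t < norm z}. ennreal (g z) \<partial>lborel) = ennreal (t powr - s) * G" if "0 < t" for t
    unfolding G_def g_def by (rule cone_power_tail_integral[OF E that])
  have tail: "emeasure (law_of_density f) {z. t < norm z} = (\<integral>\<^sup>+z\<in>{z. t < norm z}. ennreal (f z) \<partial>lborel)" for t
    by (rule emeasure_law_of_density[OF f]) measurable
  have lower: "ennreal (b\<^sub>1 * t powr - s) * G \<le> emeasure (law_of_density f) {z. t < norm z}" if "T \<le> t" for t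
  proof -
    have "ennreal (b\<^sub>1 * t powr - s) * G = ennreal b\<^sub>1 * (\<integral>\<^sup>+z\<in>E \<inter> {z. t < norm z}. ennreal (g z) \<partial>lborel)"
      using b T that by (simp add: scale ennreal_mult mult.assoc)
    also have "\<dots> = (\<integral>\<^sup>+z. ennreal b\<^sub>1 * (ennreal (g z) * indicator (E \<inter> {z. t < norm z}) z) \<partial>lborel)"
      by (subst nn_integral_cmult) simp_all
    also have "\<dots> \<le> (\<integral>\<^sup>+z\<in>{z. t < norm z}. ennreal (f z) \<partial>lborel)"
      using b lo that by (intro nn_integral_mono) (auto simp: indicator_def g_def simp flip: ennreal_mult' intro!: ennreal_leI)
    finally show ?thesis by (simp add: tail)
  qed
  \<comment> \<open>No sign of \<open>b\<^sub>2\<close> is assumed; \<open>max 1 b\<^sub>2\<close>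
    makes the resulting constant positive.\<close>
  have upper: "emeasure (law_of_density f) {z. t < norm z} \<le> ennreal (max 1 b\<^sub>2 * t powr - s) * G" if "T \<le> t" for t
  proof -
    have "(\<integral>\<^sup>+z\<in>{z. t < norm z}. ennreal (f z) \<partial>lborel) \<le> 
      (\<integral>\<^sup>+z. ennreal (max 1 b\<^sub>2) * (ennreal (g z) * indicator (E \<inter> {z. t < norm z}) z) \<partial>lborel)"
    proof (intro nn_integral_mono)
      fix z :: 'a
      have "f z \<le> max 1 b\<^sub>2 * g z" if "z \<in> E" "t < norm z"
        using up[of z] that \<open>T \<le> t\<close> mult_right_mono[of b\<^sub>2 "max 1 b\<^sub>2" "g z"] by (simp add: g_def)
      then show "ennreal (f z) * indicator {z. t < norm z} z
          \<le> ennreal (max 1 b\<^sub>2) * (ennreal (g z) * indicator (E \<inter> {z. t < norm z}) z)"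
        using f0(2)[of z] by (auto simp: indicator_def simp flip: ennreal_mult' intro!: ennreal_leI)
    qed
    also have "\<dots> = ennreal (max 1 b\<^sub>2) * (\<integral>\<^sup>+z\<in>E \<inter> {z. t < norm z}. ennreal (g z) \<partial>lborel)"
      by (subst nn_integral_cmult) simp_all
    also have "\<dots> = ennreal (max 1 b\<^sub>2 * t powr - s) * G"
      using b T that by (simp add: scale ennreal_mult mult.assoc)
    finally show ?thesis by (simp add: tail)
  qed
  \<comment> \<open>The lower bound at \<open>T\<close> is at most the total mass one, which makes
    \<open>G\<close> finite.\<close>
  have "ennreal (b\<^sub>1 * T powr - s) * G \<le> 1"
    using lower[of T] P.emeasure_le_1 order_trans by blast
  then have fin: "G < \<infinity>"
    using b T by (auto simp: less_top[symmetric] ennreal_mult_top top_unique)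
  \<comment> \<open>If \<open>G\<close> vanished, scaling would make \<open>g\<close> vanish almost
    everywhere on each set of points of \<open>E\<close> with norm above 1/(n + 1). These sets
    exhaust \<open>E\<close> without the origin, so \<open>E\<close> would be a null set and
    \<open>f\<close> could not have integral one.\<close>
  have "G \<noteq> 0"
  proof
    assume "G = 0"
    have null: "AE z in lborel. \<not> (z \<in> E \<and> 1 / real (Suc n) < norm z)" for n
    proof -
      have "(\<integral>\<^sup>+z\<in>E \<inter> {z. 1 / real (Suc n) < norm z}. ennreal (g z) \<partial>lborel) = 0"
        by (subst scale) (simp_all add: \<open>G = 0\<close>)
      then have "AE z in lborel. ennreal (g z) * indicator (E \<inter> {z. 1 / real (Suc n) < norm z}) z = 0"
        by (subst (asm) nn_integral_0_iff_AE) simp_all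
      then show ?thesis
      proof eventually_elim
        case (elim z)
        have "g z \<noteq> 0" if "1 / real (Suc n) < norm z"
        proof -
          have "0 < norm z" using that by (rule le_less_trans[rotated]) simp
          then show ?thesis by (simp add: g_def)
        qed
        moreover have "0 \<le> g z" by (simp add: g_def)
        ultimately show ?case using elim by (auto simp: indicator_def)
      qed
    qed
    then have "AE z in lborel. \<forall>n. \<not> (z \<in> E \<and> 1 / real (Suc n) < norm z)"
      unfolding AE_all_countable by blast
    moreover have "AE z in lborel. z \<noteq> (0::'a)"
      by (rule AE_lborel_singleton)
    ultimately have "AE z in lborel. ennreal (f z) = 0"
    proof eventually_elim
      case (elim z)
      then obtain n where "1 / real (Suc n) < norm z"
        using nat_approx_posE[of "norm z"] by auto
      then show ?case using elim f0 by auto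
    qed
    then have "(\<integral>\<^sup>+z. ennreal (f z) \<partial>lborel) = 0"
      by (subst nn_integral_0_iff_AE) simp_all
    then show False
      using P.emeasure_space_1 emeasure_law_of_density[OF f, of UNIV] by (simp add: law_of_density_def)
  qed
  have G: "G = ennreal (enn2real G)" "0 < enn2real G"
    using fin \<open>G \<noteq> 0\<close> by (auto simp: enn2real_positive_iff zero_less_iff_neq_zero)
  show ?thesis
  proof
    show "0 < b\<^sub>1 * enn2real G" "0 < max 1 b\<^sub>2 * enn2real G" using b G by auto
    fix t assume t: "T \<le> t"
    have "ennreal (b\<^sub>1 * t powr - s * enn2real G) \<le> ennreal (measure (law_of_density f) {z. t < norm z})"
      using lower[OF t] G b by (simp add: P.emeasure_eq_measure ennreal_mult'')
    then show "b\<^sub>1 * enn2real G * t powr - s \<le> measure (law_of_density f) {z. t < norm z}"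
      by (simp add: mult_ac)
    have "ennreal (measure (law_of_density f) {z. t < norm z}) \<le> ennreal (max 1 b\<^sub>2 * t powr - s * enn2real G)"
      using upper[OF t] G b by (simp add: P.emeasure_eq_measure ennreal_mult'')
    then show "measure (law_of_density f) {z. t < norm z} \<le> max 1 b\<^sub>2 * enn2real G * t powr - s"
      using G(2) by (subst (asm) ennreal_le_iff) (auto simp add: mult_ac)
  qed
qed

section \<open>Conditional angular densities\<close>

lemma powr_tail_integral:
  fixes s t :: real
  assumes "0 < s" "0 < t"
  shows "set_integrable lborel {t<..} (\<lambda>r. r powr - (s + 1))"
    and "(LINT r:{t<..}|lborel. r powr - (s + 1)) = t powr - s / s"
proof -
  have hi: "((\<lambda>r. r powr - (s + 1)) has_integral t powr - s / s) {t..}"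
    using has_integral_powr_to_inf[of "- (s + 1)" t] assms by simp
  have "((\<lambda>r. r powr - (s + 1)) has_integral t powr - s / s) {t<..}"
  proof (rule has_integral_spike_set_eq[THEN iffD1, OF _ _ hi])
    show "negligible {x \<in> {t..} - {t<..}. x powr - (s + 1) \<noteq> 0}"
      by (rule negligible_subset[of "{t}"]) auto
    show "negligible {x \<in> {t<..} - {t..}. x powr - (s + 1) \<noteq> 0}"
      by (rule negligible_subset[of "{t}"]) auto
  qed
  then have "(\<integral>\<^sup>+r. ennreal (r powr - (s + 1)) * indicator {t<..} r \<partial>lborel) = ennreal (t powr - s / s)"
    by (intro nn_integral_has_integral_lebesgue') auto
  then have "has_bochner_integral lborel (\<lambda>r. indicator {t<..} r *\<^sub>R r powr - (s + 1)) (t powr - s / s)"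
    using assms by (intro has_bochner_integral_nn_integral)
      (auto simp: indicator_mult_ennreal[symmetric] mult.commute intro!: nn_integral_cong)
  then show "set_integrable lborel {t<..} (\<lambda>r. r powr - (s + 1))"
    "(LINT r:{t<..}|lborel. r powr - (s + 1)) = t powr - s / s"
    unfolding set_integrable_def set_lebesgue_integral_def
    by (auto simp: has_bochner_integral_iff)
qed

text \<open>Along the ray through \<open>\<theta>\<close>, the integrand r^(d-1) f(r theta) lies
  between (w - e) r^-(s+1) and (w + e) r^-(s+1). The integral of r^-(s+1) beyond t is t^-s / s,
  which the factor s t^s removes, and the tail probability cancels the normalization of the
  conditional density.\<close>

lemma cond_angular_density_approx:
  fixes f :: "'a::euclidean_space \<Rightarrow> real"
  assumes f: "density_on_cone E f" and s: "0 < s" and t: "0 < t"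
    and pos: "0 < measure (law_of_density f) {z. t < norm z}"
    and approx: "\<And>r. t < r \<Longrightarrow> \<bar>r powr (s + real DIM('a)) * f (r *\<^sub>R \<theta>) - w\<bar> \<le> e"
  shows "\<bar>s * t powr s * measure (law_of_density f) {z. t < norm z} * cond_angular_density f t \<theta> - w\<bar> \<le> e"
proof -
  have [measurable]: "f \<in> borel_measurable borel" using f by (simp add: density_on_cone_def)
  define g where "g = (\<lambda>r. r ^ (DIM('a) - 1) * f (r *\<^sub>R \<theta>))"
  define h where "h = (\<lambda>r::real. r powr - (s + 1))"
  have [measurable]: "g \<in> borel_measurable borel" unfolding g_def by measurable
  have g: "(w - e) * h r \<le> g r" "g r \<le> (w + e) * h r" if "t < r" for r
  proof -
    have "0 < r" using t that by simp
    then have "r ^ (DIM('a) - 1) = r powr (s + real DIM('a)) * h r"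
      by (simp add: h_def of_nat_diff flip: powr_realpow powr_add)
    then have "g r = r powr (s + real DIM('a)) * f (r *\<^sub>R \<theta>) * h r"
      by (simp add: g_def mult_ac)
    moreover have "0 \<le> h r" by (simp add: h_def)
    ultimately show "(w - e) * h r \<le> g r" "g r \<le> (w + e) * h r"
      using approx[OF that] by (auto intro!: mult_right_mono simp: abs_le_iff)
  qed
  have h_int: "set_integrable lborel {t<..} h" "(LINT r:{t<..}|lborel. h r) = t powr - s / s"
    unfolding h_def using powr_tail_integral[OF s t] by auto
  \<comment> \<open>Monotonicity of the Lebesgue integral requires integrability of
    \<open>g\<close>. The absolute values in the dominating function cover either sign of
    \<open>w\<close>.\<close>
  have "set_integrable lborel {t<..} g"
  proof (rule set_integrable_bound)
    show "set_integrable lborel {t<..} (\<lambda>r. (\<bar>w\<bar> + \<bar>e\<bar>) * h r)"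
      using h_int(1) by (rule set_integrable_mult_right)
    show "set_borel_measurable lborel {t<..} g"
      unfolding set_borel_measurable_def by measurable
    show "AE r in lborel. r \<in> {t<..} \<longrightarrow> norm (g r) \<le> norm ((\<bar>w\<bar> + \<bar>e\<bar>) * h r)"
    proof (intro AE_I2 impI)
      fix r assume "r \<in> {t<..}"
      then have r: "t < r" by simp
      have h: "0 \<le> h r" by (simp add: h_def)
      have "(w + e) * h r \<le> (\<bar>w\<bar> + \<bar>e\<bar>) * h r" "- ((\<bar>w\<bar> + \<bar>e\<bar>) * h r) \<le> (w - e) * h r"
        using h by (auto intro!: mult_right_mono simp flip: mult_minus_left)
      then show "norm (g r) \<le> norm ((\<bar>w\<bar> + \<bar>e\<bar>) * h r)"
        using g[OF r] h by (simp add: abs_mult abs_le_iff)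
    qed
  qed
  then have "(LINT r:{t<..}|lborel. (w - e) * h r) \<le> (LINT r:{t<..}|lborel. g r)"
    "(LINT r:{t<..}|lborel. g r) \<le> (LINT r:{t<..}|lborel. (w + e) * h r)"
    using g h_int(1) by (intro set_integral_mono set_integrable_mult_right; simp)+
  then have bounds: "(w - e) * (t powr - s / s) \<le> (LINT r:{t<..}|lborel. g r)"
    "(LINT r:{t<..}|lborel. g r) \<le> (w + e) * (t powr - s / s)"
    using h_int(2) by simp_all
  have one: "s * t powr s * (x * (t powr - s / s)) = x" for x
    using s t by (simp add: powr_minus)
  have pos': "0 \<le> s * t powr s" using s t by simp
  have "w - e \<le> s * t powr s * (LINT r:{t<..}|lborel. g r)"
    using mult_left_mono[OF bounds(1) pos'] unfolding one .
  moreover have "s * t powr s * (LINT r:{t<..}|lborel. g r) \<le> w + e"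
    using mult_left_mono[OF bounds(2) pos'] unfolding one .
  moreover have "(LINT r:{t<..}|lborel. g r) = 
      measure (law_of_density f) {z. t < norm z} * cond_angular_density f t \<theta>"
    using pos by (simp add: cond_angular_density_def g_def)
  ultimately show ?thesis by (simp add: abs_le_iff mult_ac)
qed

section \<open>Uniform bounds over all directions\<close>

lemma compact_unit_dirs: "closed E \<Longrightarrow> compact (unit_dirs (E :: 'a::euclidean_space set))"
  using closed_Int_compact[OF _ compact_sphere, of E 0 1]
  by (simp add: unit_dirs_def sphere_def Collect_conj_eq)

text \<open>For large \<open>t\<close> the rescaled densities evaluate \<open>f\<close> only where
  it is continuous, so their uniform limit \<open>\<phi>star\<close> is continuous on the compact
  set of directions. It attains its extremes there, and the minimum is positive.\<close>

lemma regularly_varying_limit_bounds: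
  fixes E :: "'a::euclidean_space set"
  assumes E: "closed E" "cone E" and rv: "density_regularly_varying E f s \<phi>star"
  obtains b\<^sub>1 b\<^sub>2 where "0 < b\<^sub>1" "0 < b\<^sub>2" "\<And>\<theta>. \<theta> \<in> unit_dirs E \<Longrightarrow> b\<^sub>1 \<le> \<phi>star \<theta>"
    "\<And>\<theta>. \<theta> \<in> unit_dirs E \<Longrightarrow> \<phi>star \<theta> \<le> b\<^sub>2"
proof (cases "unit_dirs E = {}")
  case True
  then show ?thesis using that[of 1 1] by simp
next
  case False
  have sub: "unit_dirs E \<subseteq> E - {0}" by (auto simp: unit_dirs_def)
  obtain r\<^sub>0 where r0: "0 < r\<^sub>0" "continuous_on (E - cball 0 r\<^sub>0) f"
    using rv by (auto simp: density_regularly_varying_def)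
  have "uniform_limit (unit_dirs E) (\<lambda>t z. t powr (s + real DIM('a)) * f (t *\<^sub>R z)) \<phi>star at_top"
    using rv compact_unit_dirs[OF E(1)] sub by (simp add: density_regularly_varying_def)
  moreover have "\<forall>\<^sub>F t in at_top. continuous_on (unit_dirs E) (\<lambda>z. t powr (s + real DIM('a)) * f (t *\<^sub>R z))"
    using eventually_gt_at_top[of r\<^sub>0]
  proof eventually_elim
    case (elim t)
    have "(\<lambda>z. t *\<^sub>R z) ` unit_dirs E \<subseteq> E - cball 0 r\<^sub>0"
      using elim r0 mem_cone[OF E(2), of _ t] by (auto simp: unit_dirs_def)
    then show ?case
      by (intro continuous_intros continuous_on_compose2[OF r0(2)]) auto
  qed
  ultimately have cont: "continuous_on (unit_dirs E) \<phi>star"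
    by (intro uniform_limit_theorem) (auto simp: trivial_limit_at_top_linorder)
  obtain \<theta>\<^sub>1 where 1: "\<theta>\<^sub>1 \<in> unit_dirs E" "\<And>\<theta>. \<theta> \<in> unit_dirs E \<Longrightarrow> \<phi>star \<theta>\<^sub>1 \<le> \<phi>star \<theta>"
    using continuous_attains_inf[OF compact_unit_dirs[OF E(1)] False cont] by blast
  obtain \<theta>\<^sub>2 where 2: "\<theta>\<^sub>2 \<in> unit_dirs E" "\<And>\<theta>. \<theta> \<in> unit_dirs E \<Longrightarrow> \<phi>star \<theta> \<le> \<phi>star \<theta>\<^sub>2"
    using continuous_attains_sup[OF compact_unit_dirs[OF E(1)] False cont] by blast
  show ?thesis
    using that[of "\<phi>star \<theta>\<^sub>1" "\<phi>star \<theta>\<^sub>2"] 1 2 rv sub by (auto simp: density_regularly_varying_def)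
qed

text \<open>This collects everything needed about the tail beyond one common radius
  \<open>T\<close>. The two-sided power bounds on \<open>f\<close> follow once the second-order
  error is below half the minimum of \<open>\<phi>star\<close>.\<close>

lemma second_order_tail_bounds:
  fixes E :: "'a::euclidean_space set"
  assumes E: "closed E" "cone E"
    and rv: "density_regularly_varying E f s \<phi>star"
    and so: "second_order_condition E f s \<phi>star \<gamma>"
  obtains T C b\<^sub>1 b\<^sub>2 where "1 \<le> T" "0 < C" "0 < b\<^sub>1" "0 < b\<^sub>2"
    "\<And>\<theta>. \<theta> \<in> unit_dirs E \<Longrightarrow> 0 \<le> \<phi>star \<theta>"
    "\<And>\<theta>. \<theta> \<in> unit_dirs E \<Longrightarrow> \<phi>star \<theta> \<le> b\<^sub>2"
    "\<And>t r \<theta>. T \<le> t \<Longrightarrow> t < r \<Longrightarrow> \<theta> \<in> unit_dirs E \<Longrightarrow>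
      \<bar>r powr (s + real DIM('a)) * f (r *\<^sub>R \<theta>) - \<phi>star \<theta>\<bar> \<le> C * t powr - \<gamma>"
    "\<And>z. z \<in> E \<Longrightarrow> T < norm z \<Longrightarrow> b\<^sub>1 * norm z powr - (s + real DIM('a)) \<le> f z"
    "\<And>z. z \<in> E \<Longrightarrow> T < norm z \<Longrightarrow> f z \<le> b\<^sub>2 * norm z powr - (s + real DIM('a))"
proof -
  obtain b\<^sub>1 b\<^sub>2 where b: "0 < b\<^sub>1" "0 < b\<^sub>2" "\<And>\<theta>. \<theta> \<in> unit_dirs E \<Longrightarrow> b\<^sub>1 \<le> \<phi>star \<theta>"
    "\<And>\<theta>. \<theta> \<in> unit_dirs E \<Longrightarrow> \<phi>star \<theta> \<le> b\<^sub>2"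
    using regularly_varying_limit_bounds[OF E rv] by blast
  from so obtain C\<^sub>0 T\<^sub>0 where \<gamma>: "0 < \<gamma>" and C0: "\<And>t r \<theta>. T\<^sub>0 \<le> t \<Longrightarrow> t < r \<Longrightarrow> \<theta> \<in> unit_dirs E \<Longrightarrow>
      \<bar>r powr (s + real DIM('a)) * f (r *\<^sub>R \<theta>) - \<phi>star \<theta>\<bar> \<le> C\<^sub>0 * t powr - \<gamma>"
    unfolding second_order_condition_def eventually_at_top_linorder by blast
  \<comment> \<open>The constant in the second-order condition may be zero or negative; enlarging it
    makes it positive.\<close>
  define C where "C = max 1 C\<^sub>0"
  have C: "\<bar>r powr (s + real DIM('a)) * f (r *\<^sub>R \<theta>) - \<phi>star \<theta>\<bar> \<le> C * t powr - \<gamma>"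
    if "T\<^sub>0 \<le> t" "t < r" "\<theta> \<in> unit_dirs E" for t r \<theta>
    using C0[OF that] mult_right_mono[of C\<^sub>0 C "t powr - \<gamma>"] by (simp add: C_def)
  have "((\<lambda>t. C * t powr - \<gamma>) \<longlongrightarrow> C * 0) at_top"
    using \<gamma> by (intro tendsto_intros tendsto_neg_powr filterlim_ident) auto
  then have "\<forall>\<^sub>F t in at_top. C * t powr - \<gamma> < b\<^sub>1 / 2"
    using b by (intro order_tendstoD) auto
  then obtain T\<^sub>1 where T1: "\<And>t. T\<^sub>1 \<le> t \<Longrightarrow> C * t powr - \<gamma> < b\<^sub>1 / 2"
    unfolding eventually_at_top_linorder by blast
  define T where "T = max 1 (max T\<^sub>0 T\<^sub>1)"
  have T: "1 \<le> T" "T\<^sub>0 \<le> T" "T\<^sub>1 \<le> T" by (auto simp: T_def)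
  have f: "b\<^sub>1 / 2 * norm z powr - (s + real DIM('a)) \<le> f z"
      "f z \<le> (b\<^sub>2 + b\<^sub>1) * norm z powr - (s + real DIM('a))" if "z \<in> E" "T < norm z" for z
  proof -
    have nz: "0 < norm z" using that T by linarith
    define \<theta> where "\<theta> = z /\<^sub>R norm z"
    have \<theta>: "\<theta> \<in> unit_dirs E" "norm z *\<^sub>R \<theta> = z"
      using nz mem_cone[OF E(2) that(1), of "inverse (norm z)"] by (auto simp: \<theta>_def unit_dirs_def)
    have "\<bar>norm z powr (s + real DIM('a)) * f z - \<phi>star \<theta>\<bar> \<le> b\<^sub>1 / 2"
      using C[of T "norm z" \<theta>] T1[of T] that \<theta> T by simp
    then have "b\<^sub>1 / 2 \<le> norm z powr (s + real DIM('a)) * f z" "norm z powr (s + real DIM('a)) * f z \<le> b\<^sub>2 + b\<^sub>1"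
      using b(1) b(3,4)[OF \<theta>(1)] unfolding abs_le_iff by linarith+
    moreover have "norm z powr - (s + real DIM('a)) * (norm z powr (s + real DIM('a)) * f z) = f z"
      using nz by (simp flip: powr_add mult.assoc)
    ultimately show "b\<^sub>1 / 2 * norm z powr - (s + real DIM('a)) \<le> f z"
      "f z \<le> (b\<^sub>2 + b\<^sub>1) * norm z powr - (s + real DIM('a))"
      by (metis mult.commute mult_left_mono powr_ge_zero)+
  qed
  show ?thesis
  proof (rule that[of T C "b\<^sub>1/2" "b\<^sub>2 + b\<^sub>1"])
    show "0 < C" by (simp add: C_def)
    show "\<phi>star \<theta> \<le> b\<^sub>2 + b\<^sub>1" "0 \<le> \<phi>star \<theta>" if "\<theta> \<in> unit_dirs E" for \<theta>
      using b(1) b(3,4)[OF that] by auto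
  qed (use b T C f in auto)
qed

section \<open>Stochastic orders in outer probability\<close>

text \<open>Each set has a measurable hull of the same measure, so subadditivity carries over from
  measurable sets.\<close>

lemma outer_measure_of_Un_le:
  assumes "A \<subseteq> space M" "B \<subseteq> space M"
  shows "outer_measure_of M (A \<union> B) \<le> outer_measure_of M A + outer_measure_of M B"
proof -
  obtain A' where A': "A' \<in> sets M" "A \<subseteq> A'" "outer_measure_of M A = emeasure M A'"
    using outer_measure_of_attain[OF assms(1)] by blast
  obtain B' where B': "B' \<in> sets M" "B \<subseteq> B'" "outer_measure_of M B = emeasure M B'"
    using outer_measure_of_attain[OF assms(2)] by blast
  have "outer_measure_of M (A \<union> B) \<le> outer_measure_of M (A' \<union> B')"
    using A' B' by (intro outer_measure_of_mono) auto
  also have "\<dots> \<le> emeasure M A' + emeasure M B'"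
    using A' B' by (simp add: emeasure_subadditive)
  finally show ?thesis using A' B' by simp
qed

lemma tendsto_0_ennreal_le:
  fixes f g :: "nat \<Rightarrow> ennreal"
  assumes "g \<longlonglongrightarrow> 0" "\<forall>\<^sub>F n in sequentially. f n \<le> g n"
  shows "f \<longlonglongrightarrow> 0"
  by (rule tendsto_sandwich[OF _ assms(2) tendsto_const assms(1)]) simp

lemma with_prob_tending_to_one_conj:
  assumes "with_prob_tending_to_one M Q" "with_prob_tending_to_one M R"
  shows "with_prob_tending_to_one M (\<lambda>n \<omega>. Q n \<omega> \<and> R n \<omega>)"
proof -
  have "(\<lambda>n. outer_measure_of M {\<omega> \<in> space M. \<not> Q n \<omega>} + outer_measure_of M {\<omega> \<in> space M. \<not> R n \<omega>}) \<longlonglongrightarrow> 0 + 0"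
    using assms unfolding with_prob_tending_to_one_def by (rule tendsto_add)
  then have "(\<lambda>n. outer_measure_of M {\<omega> \<in> space M. \<not> Q n \<omega>} + outer_measure_of M {\<omega> \<in> space M. \<not> R n \<omega>}) \<longlonglongrightarrow> 0"
    by simp
  moreover have "outer_measure_of M {\<omega> \<in> space M. \<not> (Q n \<omega> \<and> R n \<omega>)}
      \<le> outer_measure_of M {\<omega> \<in> space M. \<not> Q n \<omega>} + outer_measure_of M {\<omega> \<in> space M. \<not> R n \<omega>}" for n
    by (rule order_trans[OF outer_measure_of_mono outer_measure_of_Un_le]) auto
  ultimately have "(\<lambda>n. outer_measure_of M {\<omega> \<in> space M. \<not> (Q n \<omega> \<and> R n \<omega>)}) \<longlonglongrightarrow> 0"
    by (rule tendsto_0_ennreal_le[OF _ always_eventually[OF allI]])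
  then show ?thesis unfolding with_prob_tending_to_one_def .
qed

text \<open>This separates probability from analysis: it remains to prove an implication for each
  sample point, with a constant depending only on \<open>C\<^sub>1\<close> and
  \<open>C\<^sub>2\<close> and a threshold in \<open>n\<close> common to all sample points. The
  three exceptional events each receive a third of \<open>\<epsilon>\<close>.\<close>

lemma big_O_P_combine:
  assumes "big_O_P M X\<^sub>1 a\<^sub>1" "big_O_P M X\<^sub>2 a\<^sub>2" "with_prob_tending_to_one M Q"
    and imp: "\<And>C\<^sub>1 C\<^sub>2. 0 < C\<^sub>1 \<Longrightarrow> 0 < C\<^sub>2 \<Longrightarrow> \<exists>C>0. \<forall>\<^sub>F n in sequentially. \<forall>\<omega>\<in>space M.
      Q n \<omega> \<longrightarrow> X\<^sub>1 n \<omega> \<le> ennreal (C\<^sub>1 * a\<^sub>1 n \<omega>) \<longrightarrow> X\<^sub>2 n \<omega> \<le> ennreal (C\<^sub>2 * a\<^sub>2 n \<omega>) \<longrightarrow> X n \<omega> \<le> ennreal (C * a n \<omega>)"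
  shows "big_O_P M X a"
  unfolding big_O_P_def
proof (intro allI impI)
  fix \<epsilon> :: real assume \<epsilon>: "0 < \<epsilon>"
  then have "0 < \<epsilon> / 3" by simp
  obtain C\<^sub>1 where C1: "0 < C\<^sub>1" "\<forall>\<^sub>F n in sequentially.
      outer_measure_of M {\<omega> \<in> space M. X\<^sub>1 n \<omega> > ennreal (C\<^sub>1 * a\<^sub>1 n \<omega>)} \<le> ennreal (\<epsilon>/3)"
    using assms(1) \<open>0 < \<epsilon> / 3\<close> unfolding big_O_P_def by blast
  obtain C\<^sub>2 where C2: "0 < C\<^sub>2" "\<forall>\<^sub>F n in sequentially.
      outer_measure_of M {\<omega> \<in> space M. X\<^sub>2 n \<omega> > ennreal (C\<^sub>2 * a\<^sub>2 n \<omega>)} \<le> ennreal (\<epsilon>/3)"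
    using assms(2) \<open>0 < \<epsilon> / 3\<close> unfolding big_O_P_def by blast
  have Q: "\<forall>\<^sub>F n in sequentially. outer_measure_of M {\<omega> \<in> space M. \<not> Q n \<omega>} < ennreal (\<epsilon>/3)"
    using assms(3) \<epsilon> unfolding with_prob_tending_to_one_def by (intro order_tendstoD) auto
  obtain C where C: "0 < C" "\<forall>\<^sub>F n in sequentially. \<forall>\<omega>\<in>space M.
      Q n \<omega> \<longrightarrow> X\<^sub>1 n \<omega> \<le> ennreal (C\<^sub>1 * a\<^sub>1 n \<omega>) \<longrightarrow> X\<^sub>2 n \<omega> \<le> ennreal (C\<^sub>2 * a\<^sub>2 n \<omega>) \<longrightarrow> X n \<omega> \<le> ennreal (C * a n \<omega>)"
    using imp[OF C1(1) C2(1)] by blast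
  have "\<forall>\<^sub>F n in sequentially. outer_measure_of M {\<omega> \<in> space M. X n \<omega> > ennreal (C * a n \<omega>)} \<le> ennreal \<epsilon>"
    using C1(2) C2(2) Q C(2)
  proof eventually_elim
    case (elim n)
    let ?A = "{\<omega> \<in> space M. X\<^sub>1 n \<omega> > ennreal (C\<^sub>1 * a\<^sub>1 n \<omega>)}"
    let ?B = "{\<omega> \<in> space M. X\<^sub>2 n \<omega> > ennreal (C\<^sub>2 * a\<^sub>2 n \<omega>)}"
    let ?C = "{\<omega> \<in> space M. \<not> Q n \<omega>}"
    have "{\<omega> \<in> space M. X n \<omega> > ennreal (C * a n \<omega>)} \<subseteq> ?A \<union> (?B \<union> ?C)"
      using elim(4) by (force simp: not_less)
    then have "outer_measure_of M {\<omega> \<in> space M. X n \<omega> > ennreal (C * a n \<omega>)} \<le> outer_measure_of M (?A \<union> (?B \<union> ?C))"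
      by (rule outer_measure_of_mono)
    also have "\<dots> \<le> outer_measure_of M ?A + outer_measure_of M (?B \<union> ?C)"
      by (rule outer_measure_of_Un_le) auto
    also have "\<dots> \<le> outer_measure_of M ?A + (outer_measure_of M ?B + outer_measure_of M ?C)"
      by (intro add_left_mono outer_measure_of_Un_le) auto
    also have "\<dots> \<le> ennreal (\<epsilon>/3) + (ennreal (\<epsilon>/3) + ennreal (\<epsilon>/3))"
      using elim by (intro add_mono) auto
    also have "\<dots> = ennreal \<epsilon>"
      using \<epsilon> by (subst ennreal_plus[symmetric], simp, simp)+ simp
    finally show ?case .
  qed
  then show "\<exists>C>0. \<forall>\<^sub>F n in sequentially. outer_measure_of M {\<omega> \<in> space M. X n \<omega> > ennreal (C * a n \<omega>)} \<le> ennreal \<epsilon>"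
    using C(1) by blast
qed

section \<open>Order statistics and quantiles\<close>

lemma kth_largest_gt_iff:
  assumes "1 \<le> k" "k \<le> length xs"
  shows "x < kth_largest k xs \<longleftrightarrow> k \<le> length (filter (\<lambda>y. x < y) xs)"
proof -
  define zs where "zs = rev (sort xs)"
  have len: "length zs = length xs" by (simp add: zs_def)
  have "length (filter (\<lambda>y. x < y) xs) = length (filter (\<lambda>y. x < y) zs)"
    by (metis mset_filter mset_rev mset_sort size_mset zs_def)
  \<comment> \<open>In a descending list the entries above \<open>x\<close> form an initial segment,
    so counting them locates the entry at position \<open>k - 1\<close>.\<close>
  also have "filter (\<lambda>y. x < y) zs = takeWhile (\<lambda>y. x < y) zs"
    using filter_equals_takeWhile_sorted_rev[of "\<lambda>y. y" zs x] by (simp add: zs_def)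
  finally have eq: "length (filter (\<lambda>y. x < y) xs) = length (takeWhile (\<lambda>y. x < y) zs)" .
  show ?thesis
  proof
    assume *: "x < kth_largest k xs"
    show "k \<le> length (filter (\<lambda>y. x < y) xs)"
    proof (rule ccontr)
      assume "\<not> ?thesis"
      then have l: "length (takeWhile (\<lambda>y. x < y) zs) \<le> k - 1" "length (takeWhile (\<lambda>y. x < y) zs) < length zs"
        using assms len eq by auto
      have "\<not> x < zs ! length (takeWhile (\<lambda>y. x < y) zs)"
        using nth_length_takeWhile[OF l(2)] .
      moreover have "zs ! (k - 1) \<le> zs ! length (takeWhile (\<lambda>y. x < y) zs)"
        using l assms len sorted_rev_nth_mono[of zs] by (simp add: zs_def)
      ultimately show False using * by (simp add: kth_largest_def zs_def)
    qed
  next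
    assume "k \<le> length (filter (\<lambda>y. x < y) xs)"
    then have "k - 1 < length (takeWhile (\<lambda>y. x < y) zs)" using assms eq by simp
    then have "x < zs ! (k - 1)"
      by (metis nth_mem set_takeWhileD takeWhile_nth)
    then show "x < kth_largest k xs" by (simp add: kth_largest_def zs_def)
  qed
qed

lemma length_filter_radii:
  "real (length (filter (\<lambda>y. x < y) (radii \<xi> n \<omega>))) = (\<Sum>i<n. indicator {z. x < norm z} (\<xi> i \<omega>))"
  by (induction n) (auto simp: radii_def)

lemma kth_largest_radii_gt_iff:
  assumes "1 \<le> k" "k \<le> n"
  shows "x < kth_largest k (radii \<xi> n \<omega>) \<longleftrightarrow> real k \<le> (\<Sum>i<n. indicator {z. x < norm z} (\<xi> i \<omega>))"
  using kth_largest_gt_iff[of k "radii \<xi> n \<omega>" x] assms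
  by (simp add: radii_def flip: length_filter_radii)

section \<open>Exceedance counts and the intermediate threshold\<close>

context prob_space
begin

lemma expectation_exceedance:
  fixes X :: "'a \<Rightarrow> 'b::euclidean_space"
  assumes "distributed M lborel X (\<lambda>z. ennreal (f z))"
  shows "expectation (\<lambda>\<omega>. indicator {z. x < norm z} (X \<omega>)) = measure (law_of_density f) {z. x < norm z}"
proof -
  have [measurable]: "X \<in> borel_measurable M"
    using distributed_measurable[OF assms] by simp
  have "expectation (\<lambda>\<omega>. indicator {z. x < norm z} (X \<omega>)) = measure (distr M lborel X) {z. x < norm z}"
    using integral_distr[of X M lborel "indicator {z. x < norm z} :: 'b \<Rightarrow> real"] by simp
  also have "\<dots> = measure (law_of_density f) {z. x < norm z}"
    using distributed_distr_eq_density[OF assms] by (simp add: law_of_density_def)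
  finally show ?thesis .
qed

text \<open>The event says that at least \<open>k\<close> sample points exceed \<open>x\<close>;
  Markov's inequality is applied to their number.\<close>

lemma prob_kth_largest_gt:
  fixes \<xi> :: "nat \<Rightarrow> 'a \<Rightarrow> 'b::euclidean_space"
  assumes "\<And>i. distributed M lborel (\<xi> i) (\<lambda>z. ennreal (f z))" "1 \<le> k" "k \<le> n"
  shows "{\<omega> \<in> space M. x < kth_largest k (radii \<xi> n \<omega>)} \<in> sets M"
    and "prob {\<omega> \<in> space M. x < kth_largest k (radii \<xi> n \<omega>)}
      \<le> real n * measure (law_of_density f) {z. x < norm z} / real k"
proof -
  have [measurable]: "\<xi> i \<in> borel_measurable M" for i
    using distributed_measurable[OF assms(1)] by simp
  define S where "S = (\<lambda>\<omega>. \<Sum>i<n. indicator {z. x < norm z} (\<xi> i \<omega>) :: real)"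
  have [measurable]: "S \<in> borel_measurable M" unfolding S_def by measurable
  have eq: "{\<omega> \<in> space M. x < kth_largest k (radii \<xi> n \<omega>)} = {\<omega> \<in> space M. real k \<le> S \<omega>}"
    using kth_largest_radii_gt_iff[OF assms(2,3), of x \<xi>] by (simp add: S_def)
  show "{\<omega> \<in> space M. x < kth_largest k (radii \<xi> n \<omega>)} \<in> sets M"
    unfolding eq by measurable
  have int: "integrable M (\<lambda>\<omega>. indicator {z. x < norm z} (\<xi> i \<omega>) :: real)" for i
    by (rule integrable_const_bound[of _ 1]) auto
  have "expectation S = (\<Sum>i<n. expectation (\<lambda>\<omega>. indicator {z. x < norm z} (\<xi> i \<omega>)))"
    unfolding S_def using int by (intro Bochner_Integration.integral_sum) auto
  also have "\<dots> = real n * measure (law_of_density f) {z. x < norm z}"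
    using expectation_exceedance[OF assms(1)] by simp
  finally have E: "expectation S = real n * measure (law_of_density f) {z. x < norm z}" .
  have "integrable M S" unfolding S_def using int by (intro Bochner_Integration.integrable_sum) auto
  moreover have "0 \<le> S \<omega>" for \<omega> unfolding S_def by (intro sum_nonneg) auto
  ultimately have "prob {\<omega> \<in> space M. real k \<le> S \<omega>} \<le> expectation S / real k"
    using integral_Markov_inequality_measure[of M S "{}" "real k"] assms(2) by simp
  then show "prob {\<omega> \<in> space M. x < kth_largest k (radii \<xi> n \<omega>)}
      \<le> real n * measure (law_of_density f) {z. x < norm z} / real k"
    by (simp add: eq E)
qed

text \<open>The expected number of exceedances is at least 2k, so having fewer than k of them is a
  deviation by at least half the mean. Hoeffding's inequality bounds its probability.\<close>

lemma prob_kth_largest_le: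
  fixes \<xi> :: "nat \<Rightarrow> 'a \<Rightarrow> 'b::euclidean_space"
  assumes dist: "\<And>i. distributed M lborel (\<xi> i) (\<lambda>z. ennreal (f z))"
    and indep: "indep_vars (\<lambda>_. borel) \<xi> UNIV" and k: "1 \<le> k" "k \<le> n"
    and p: "2 * real k \<le> real n * measure (law_of_density f) {z. x < norm z}"
  shows "prob {\<omega> \<in> space M. \<not> x < kth_largest k (radii \<xi> n \<omega>)}
      \<le> exp (- real n * (measure (law_of_density f) {z. x < norm z})\<^sup>2 / 2)"
proof -
  have [measurable]: "\<xi> i \<in> borel_measurable M" for i
    using distributed_measurable[OF dist] by simp
  define p where "p = measure (law_of_density f) {z. x < norm z}"
  define X where "X = (\<lambda>i \<omega>. indicator {z. x < norm z} (\<xi> i \<omega>) :: real)"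
  have [measurable]: "X i \<in> borel_measurable M" for i unfolding X_def by measurable
  have indep: "indep_vars (\<lambda>_. borel) X {..<n}"
    unfolding X_def by (intro indep_vars_compose2[OF indep_vars_subset[OF indep]]) auto
  interpret H: Hoeffding_ineq M "{..<n}" X "\<lambda>_. 0" "\<lambda>_. 1" "real n * p"
  proof unfold_locales
    show "real n * p \<equiv> (\<Sum>i<n. expectation (X i))"
      using expectation_exceedance[OF dist] by (simp add: X_def p_def)
    show "indep_vars (\<lambda>_. borel) X {..<n}" by (rule indep)
    show "AE \<omega> in M. X i \<omega> \<in> {0..1}" for i by (simp add: X_def)
  qed simp
  have "prob {\<omega> \<in> space M. \<not> x < kth_largest k (radii \<xi> n \<omega>)} \<le> prob {\<omega> \<in> space M. (\<Sum>i<n. X i \<omega>) \<le> real n * p - real n * p / 2}"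
  proof (intro finite_measure_mono subsetI)
    fix \<omega> assume "\<omega> \<in> {\<omega> \<in> space M. \<not> x < kth_largest k (radii \<xi> n \<omega>)}"
    then have "\<omega> \<in> space M" "(\<Sum>i<n. X i \<omega>) < real k"
      using kth_largest_radii_gt_iff[OF k, of x \<xi> \<omega>] by (simp_all add: X_def)
    then show "\<omega> \<in> {\<omega> \<in> space M. (\<Sum>i<n. X i \<omega>) \<le> real n * p - real n * p / 2}"
      using p by (simp add: p_def)
  qed measurable
  also have "\<dots> \<le> exp (- 2 * (real n * p / 2)\<^sup>2 / (\<Sum>i<n. (1 - 0)\<^sup>2))"
    using k by (intro H.Hoeffding_ineq_le) (auto simp: p_def)
  also have "- 2 * (real n * p / 2)\<^sup>2 / (\<Sum>i<n. (1 - 0)\<^sup>2) = - real n * p\<^sup>2 / 2"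
    using k by (simp add: power2_eq_square)
  finally show ?thesis by (simp add: p_def)
qed

end

section \<open>Quantiles and the gap between the two thresholds\<close>

lemma quantile_lessD:
  assumes "real_distribution D" "p < 1" "quantile D p < x"
  shows "p \<le> cdf D x"
proof -
  interpret real_distribution D by fact
  \<comment> \<open>Because \<open>p\<close> is below one, the set defining the quantile is
    nonempty. The strict inequality then yields a member below \<open>x\<close>, whether or not the
    infimum is attained.\<close>
  have "\<forall>\<^sub>F y in at_top. p < cdf D y"
    using cdf_lim_at_top_prob assms(2) by (rule order_tendstoD)
  then have "{y. p \<le> cdf D y} \<noteq> {}"
    by (auto simp: eventually_at_top_linorder intro: less_imp_le)
  then obtain y where "p \<le> cdf D y" "y < x"
    using cInf_lessD[of "{y. p \<le> cdf D y}" x] assms(3) by (auto simp: quantile_def)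
  then show ?thesis using cdf_nondecreasing[of y x] by simp
qed

lemma tail_prob_beyond_quantile:
  fixes f :: "'a::euclidean_space \<Rightarrow> real"
  assumes f: "density_on_cone E f" and "0 < e" "quantile (distr (law_of_density f) borel norm) (1 - e) < x"
  shows "measure (law_of_density f) {z. x < norm z} \<le> e"
proof -
  interpret P: prob_space "law_of_density f" using f by (simp add: density_on_cone_def)
  have [simp]: "sets (law_of_density f) = sets borel" "space (law_of_density f) = UNIV"
    by (simp_all add: law_of_density_def)
  have [measurable]: "norm \<in> borel_measurable (law_of_density f)"
    by (simp add: law_of_density_def)
  interpret D: real_distribution "distr (law_of_density f) borel norm"
    by (intro P.real_distribution_distr) measurable
  have "1 - e \<le> cdf (distr (law_of_density f) borel norm) x"
    using assms by (intro quantile_lessD) (auto intro: D.real_distribution_axioms)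
  also have "\<dots> = P.prob (UNIV - {z. x < norm z})"
    by (auto simp: cdf_def measure_distr intro!: arg_cong[of _ _ P.prob])
  also have "\<dots> = 1 - P.prob {z. x < norm z}"
    using P.prob_compl[of "{z. x < norm z}"] by simp
  finally show ?thesis by simp
qed

text \<open>The power is at least one, so rounding down loses at most a factor of two.\<close>

lemma nat_floor_powr_bounds:
  fixes q :: real
  assumes q: "0 < q" "q < 1" and n: "1 \<le> n"
  defines "k \<equiv> nat \<lfloor>real n powr (1 - q)\<rfloor>"
  shows "1 \<le> k" "k \<le> n" "real k \<le> real n powr (1 - q)" "real n powr (1 - q) \<le> 2 * real k"
proof -
  have 1: "1 \<le> real n powr (1 - q)" using n q by (intro ge_one_powr_ge_zero) auto
  have 2: "real n powr (1 - q) \<le> real n powr 1" using n q by (intro powr_mono) auto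
  show 3: "1 \<le> k" using 1 by (simp add: k_def le_nat_iff)
  show 4: "real k \<le> real n powr (1 - q)" using 1 by (simp add: k_def)
  show "k \<le> n" using 4 2 n by simp
  have "real n powr (1 - q) < real k + 1" using 1 by (simp add: k_def)
  then show "real n powr (1 - q) \<le> 2 * real k" using 3 by linarith
qed

text \<open>A fixed level \<open>x\<close> is exceeded by a positive fraction of the sample, while
  \<open>k n\<close> is a vanishing fraction of \<open>n\<close>. Hence 2k is eventually below the
  expected count and the exponential bound applies.\<close>

lemma (in prob_space) kth_largest_tends_to_infinity:
  fixes \<xi> :: "nat \<Rightarrow> 'a \<Rightarrow> 'b::euclidean_space"
  assumes dist: "\<And>i. distributed M lborel (\<xi> i) (\<lambda>z. ennreal (f z))"
    and indep: "indep_vars (\<lambda>_. borel) \<xi> UNIV"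
    and k: "\<forall>\<^sub>F n in sequentially. 1 \<le> k n \<and> k n \<le> n" "(\<lambda>n. real (k n) / real n) \<longlonglongrightarrow> 0"
    and p: "0 < measure (law_of_density f) {z. x < norm z}"
  shows "with_prob_tending_to_one M (\<lambda>n \<omega>. x < kth_largest (k n) (radii \<xi> n \<omega>))"
proof -
  define p where "p = measure (law_of_density f) {z. x < norm z}"
  have "0 < p" using p by (simp add: p_def)
  have "(\<lambda>n. exp (- real n * p\<^sup>2 / 2)) \<longlonglongrightarrow> 0"
    using \<open>0 < p\<close> by real_asymp
  then have lim: "(\<lambda>n. ennreal (exp (- real n * p\<^sup>2 / 2))) \<longlonglongrightarrow> 0"
    using tendsto_ennrealI[of _ 0] by force
  have "\<forall>\<^sub>F n in sequentially. real (k n) / real n < p / 2"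
    using k(2) \<open>0 < p\<close> by (intro order_tendstoD) auto
  then have "\<forall>\<^sub>F n in sequentially. outer_measure_of M {\<omega> \<in> space M. \<not> x < kth_largest (k n) (radii \<xi> n \<omega>)}
      \<le> ennreal (exp (- real n * p\<^sup>2 / 2))"
    using k(1) eventually_gt_at_top[of 0]
  proof eventually_elim
    case (elim n)
    have "2 * real (k n) \<le> real n * p" using elim by (simp add: field_simps)
    then have "prob {\<omega> \<in> space M. \<not> x < kth_largest (k n) (radii \<xi> n \<omega>)} \<le> exp (- real n * p\<^sup>2 / 2)"
      using prob_kth_largest_le[OF dist indep] elim by (simp add: p_def)
    moreover have "{\<omega> \<in> space M. \<not> x < kth_largest (k n) (radii \<xi> n \<omega>)} \<in> sets M"
      using prob_kth_largest_gt(1)[OF dist, of "k n" n x] elim by (intro sets.sets_Collect_neg) auto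
    ultimately show ?case by (simp add: emeasure_eq_measure)
  qed
  then show ?thesis
    unfolding with_prob_tending_to_one_def by (rule tendsto_0_ennreal_le[OF lim])
qed

lemma (in prob_space) kth_largest_below:
  fixes \<xi> :: "nat \<Rightarrow> 'a \<Rightarrow> 'b::euclidean_space"
  assumes dist: "\<And>i. distributed M lborel (\<xi> i) (\<lambda>z. ennreal (f z))"
    and k: "\<forall>\<^sub>F n in sequentially. 1 \<le> k n \<and> k n \<le> n"
    and p: "(\<lambda>n. real n * measure (law_of_density f) {z. x n < norm z} / real (k n)) \<longlonglongrightarrow> 0"
  shows "with_prob_tending_to_one M (\<lambda>n \<omega>. kth_largest (k n) (radii \<xi> n \<omega>) \<le> x n)"
proof -
  have lim: "(\<lambda>n. ennreal (real n * measure (law_of_density f) {z. x n < norm z} / real (k n))) \<longlonglongrightarrow> 0"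
    using tendsto_ennrealI[OF p] by simp
  have "\<forall>\<^sub>F n in sequentially. outer_measure_of M {\<omega> \<in> space M. \<not> kth_largest (k n) (radii \<xi> n \<omega>) \<le> x n}
      \<le> ennreal (real n * measure (law_of_density f) {z. x n < norm z} / real (k n))"
    using k
  proof eventually_elim
    case (elim n)
    then show ?case
      using prob_kth_largest_gt[OF dist, of "k n" n "x n"]
      by (simp add: not_le emeasure_eq_measure ennreal_leI)
  qed
  then show ?thesis
    unfolding with_prob_tending_to_one_def by (rule tendsto_0_ennreal_le[OF lim])
qed

text \<open>A tail bounded below by c t^-s cannot reach n^-r before a radius of order n^(r/s). The
  tail probability is controlled only strictly beyond the quantile, so the bound is evaluated at
  twice the quantile.\<close>

lemma extreme_quantile_lower_bound:
  fixes f :: "'a::euclidean_space \<Rightarrow> real"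
  assumes f: "density_on_cone E f" and s: "0 < s" and r: "0 < r" and T: "1 \<le> T" and c: "0 < c"
    and lo: "\<And>t. T \<le> t \<Longrightarrow> c * t powr - s \<le> measure (law_of_density f) {z. t < norm z}"
  defines "u \<equiv> \<lambda>n. quantile (distr (law_of_density f) borel norm) (1 - real n powr - r)"
  shows "\<forall>\<^sub>F n in sequentially. B \<le> u n \<and> c * (2 * u n) powr - s \<le> real n powr - r"
proof -
  interpret P: prob_space "law_of_density f" using f by (simp add: density_on_cone_def)
  define B' where "B' = max B T"
  have B': "T \<le> B'" "B \<le> B'" by (auto simp: B'_def)
  have "(\<lambda>n. real n powr - r) \<longlonglongrightarrow> 0" using r by real_asymp
  moreover have "0 < c * B' powr - s" using c B' T by simp
  ultimately have "\<forall>\<^sub>F n in sequentially. real n powr - r < c * B' powr - s"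
    by (intro order_tendstoD)
  then show ?thesis
    using eventually_gt_at_top[of 0]
  proof eventually_elim
    case (elim n)
    have tail: "measure (law_of_density f) {z. x < norm z} \<le> real n powr - r" if "u n < x" for x
      using that elim by (intro tail_prob_beyond_quantile[OF f]) (auto simp: u_def)
    \<comment> \<open>Were the quantile below \<open>B'\<close>, the tail probability at
      \<open>B'\<close> would be at most n^-r and thus smaller than its own lower bound.\<close>
    have u: "B' \<le> u n"
      using tail[of B'] lo[OF B'(1)] elim by (force simp: not_less[symmetric])
    have "c * (2 * u n) powr - s \<le> measure (law_of_density f) {z. 2 * u n < norm z}"
      using u B' T by (intro lo) auto
    also have "\<dots> \<le> real n powr - r"
      using u B' T by (intro tail) auto
    finally show ?case using u B' by auto
  qed
qed

text \<open>The tail probabilities at \<open>\<eta> * u n\<close> and \<open>2 * u n\<close> differ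
  by at most a constant factor, so the first is of order at most n^-r. The expected number of
  exceedances divided by \<open>k n\<close> is then of order at most n^(q-r), which vanishes because
  q < 1 <= r.\<close>

lemma intermediate_below_extreme:
  fixes f :: "'a::euclidean_space \<Rightarrow> real"
  assumes f: "density_on_cone E f" and s: "0 < s" and q: "0 < q" "q < 1" and r: "1 \<le> r" 
    and T: "1 \<le> T" and c: "0 < c\<^sub>1" "0 < c\<^sub>2"
    and lo: "\<And>t. T \<le> t \<Longrightarrow> c\<^sub>1 * t powr - s \<le> measure (law_of_density f) {z. t < norm z}"
    and up: "\<And>t. T \<le> t \<Longrightarrow> measure (law_of_density f) {z. t < norm z} \<le> c\<^sub>2 * t powr - s"
    and \<eta>: "0 < \<eta>"
  defines "u \<equiv> \<lambda>n. quantile (distr (law_of_density f) borel norm) (1 - real n powr - r)"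
    and "k \<equiv> \<lambda>n. nat \<lfloor>real n powr (1 - q)\<rfloor>"
  shows "(\<lambda>n. real n * measure (law_of_density f) {z. \<eta> * u n < norm z} / real (k n)) \<longlonglongrightarrow> 0"
proof (rule tendsto_sandwich[OF _ _ tendsto_const])
  \<comment> \<open>This is the ratio of the upper power bound at \<open>\<eta> * u n\<close> to the
    lower one at \<open>2 * u n\<close>.\<close>
  define C where "C = c\<^sub>2 * (\<eta> / 2) powr - s / c\<^sub>1"
  have "(\<lambda>n. real n powr (q - r)) \<longlonglongrightarrow> 0" using q r by real_asymp
  then show "(\<lambda>n. 2 * C * real n powr (q - r)) \<longlonglongrightarrow> 0"
    by (rule tendsto_mult_right_zero)
  \<comment> \<open>The bound \<open>T / \<eta>\<close> places \<open>\<eta> * u n\<close> in the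
    range of the upper tail estimate.\<close>
  have "\<forall>\<^sub>F n in sequentially. max 1 (T / \<eta>) \<le> u n \<and> c\<^sub>1 * (2 * u n) powr - s \<le> real n powr - r"
    unfolding u_def using r by (intro extreme_quantile_lower_bound[OF f s _ T c(1) lo]) auto
  then show "\<forall>\<^sub>F n in sequentially. real n * measure (law_of_density f) {z. \<eta> * u n < norm z} / real (k n)
      \<le> 2 * C * real n powr (q - r)"
    using eventually_ge_at_top[of 1]
  proof eventually_elim
    case (elim n)
    have k: "1 \<le> k n" "real n powr (1 - q) \<le> 2 * real (k n)"
      unfolding k_def using nat_floor_powr_bounds[OF q elim(2)] by auto
    have u: "1 \<le> u n" "T \<le> \<eta> * u n"
      using elim \<eta> by (auto simp: field_simps)
    have "measure (law_of_density f) {z. \<eta> * u n < norm z} \<le> c\<^sub>2 * (\<eta> * u n) powr - s"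
      using u by (intro up)
    also have "\<dots> = C * (c\<^sub>1 * (2 * u n) powr - s)"
      using c u \<eta> by (simp add: C_def powr_mult powr_divide)
    also have "\<dots> \<le> C * real n powr - r"
      using elim c by (intro mult_left_mono) (auto simp: C_def)
    finally have "real n * measure (law_of_density f) {z. \<eta> * u n < norm z} / real (k n) \<le> real n * (C * real n powr - r) / real (k n)"
      by (intro divide_right_mono mult_left_mono) auto
    also have "\<dots> \<le> real n * (C * real n powr - r) / (real n powr (1 - q) / 2)"
      using k c elim by (intro divide_left_mono) (auto simp: C_def)
    also have "\<dots> = 2 * C * (real n powr 1 * real n powr - r / real n powr (1 - q))"
      using elim by simp
    also have "real n powr 1 * real n powr - r / real n powr (1 - q) = real n powr (q - r)"
      using elim by (simp only: powr_add[symmetric] powr_diff[symmetric]) (simp add: algebra_simps)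
    finally show ?case .
  qed
qed simp

section \<open>Perturbation of maximizers\<close>

text \<open>The inequality 1 + y <= exp y gives a one-sided estimate; exchanging the two exponents
  gives the other side.\<close>

lemma powr_exponent_lipschitz:
  fixes x :: real
  assumes x: "0 < x" and P: "x powr a \<le> P" "x powr b \<le> P"
  shows "\<bar>x powr a - x powr b\<bar> \<le> P * \<bar>ln x\<bar> * \<bar>a - b\<bar>"
proof -
  have *: "x powr a - x powr b \<le> P * \<bar>ln x\<bar> * \<bar>a - b\<bar>" if "x powr a \<le> P" for a b
  proof -
    have "1 + (b - a) * ln x \<le> x powr (b - a)"
      unfolding powr_def using exp_ge_add_one_self x by simp
    then have "1 - x powr (b - a) \<le> - ((b - a) * ln x)" by linarith
    also have "\<dots> \<le> \<bar>ln x\<bar> * \<bar>a - b\<bar>"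
      using abs_ge_minus_self[of "(b - a) * ln x"] by (simp add: abs_mult abs_minus_commute mult.commute)
    finally have "x powr a * (1 - x powr (b - a)) \<le> P * (\<bar>ln x\<bar> * \<bar>a - b\<bar>)"
      using that by (intro order_trans[OF mult_left_mono mult_right_mono]) auto
    then show ?thesis
      using x by (simp add: right_diff_distrib mult.assoc flip: powr_add)
  qed
  show ?thesis
    using *[OF P(1), of b] *[OF P(2), of a] by (simp add: abs_le_iff abs_minus_commute)
qed

text \<open>In the application \<open>y\<close> is the limiting angular value, \<open>w\<close> its
  pre-limit version, \<open>h\<close> its estimate and \<open>\<beta>\<close> the estimated radial
  exponent. Restricting \<open>x\<close> to an interval away from zero yields one constant for all
  points of the localization set.\<close>

lemma radial_perturbation:
  fixes \<alpha> A b \<rho>\<^sub>0 \<rho>\<^sub>1 :: real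
  assumes \<alpha>: "0 \<le> \<alpha>" and A: "0 \<le> A" and b: "0 \<le> b" and \<rho>: "0 < \<rho>\<^sub>0"
  obtains B where "0 < B" "\<And>x \<beta> w h y. \<rho>\<^sub>0 \<le> x \<Longrightarrow> x \<le> \<rho>\<^sub>1 \<Longrightarrow> 0 \<le> \<beta> \<Longrightarrow> \<bar>\<beta> - \<alpha>\<bar> \<le> A \<Longrightarrow>
    0 \<le> y \<Longrightarrow> y \<le> b \<Longrightarrow>
    \<bar>x powr - \<alpha> * w - x powr - \<beta> * h\<bar> \<le> B * (\<bar>w - y\<bar> + \<bar>h - y\<bar> + \<bar>\<beta> - \<alpha>\<bar>)"
proof -
  \<comment> \<open>\<open>W\<close> is at least one and dominates 1/x on the interval, so
    \<open>P\<close> dominates all powers of \<open>x\<close> with exponent between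
    \<open>- (\<alpha> + A)\<close> and 0.\<close>
  define W where "W = max 1 (1 / \<rho>\<^sub>0)"
  define P where "P = W powr (\<alpha> + A)"
  define \<Lambda> where "\<Lambda> = max \<bar>ln \<rho>\<^sub>0\<bar> \<bar>ln \<rho>\<^sub>1\<bar>"
  have \<Lambda>0: "0 \<le> \<Lambda>" by (simp add: \<Lambda>_def)
  have P0: "0 < P" by (auto simp: P_def W_def)
  have "\<bar>x powr - \<alpha> * w - x powr - \<beta> * h\<bar> \<le> P * (1 + \<Lambda> * b) * (\<bar>w - y\<bar> + \<bar>h - y\<bar> + \<bar>\<beta> - \<alpha>\<bar>)"
    if x: "\<rho>\<^sub>0 \<le> x" "x \<le> \<rho>\<^sub>1" and \<beta>: "0 \<le> \<beta>" "\<bar>\<beta> - \<alpha>\<bar> \<le> A" and y: "0 \<le> y" "y \<le> b" for x \<beta> w h y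
  proof -
    have x0: "0 < x" using \<rho> x by simp
    have P: "x powr - e \<le> P" if "0 \<le> e" "e \<le> \<alpha> + A" for e
    proof -
      have "x powr - e = (1 / x) powr e" using x0 by (simp add: powr_minus_divide powr_divide)
      also have "\<dots> \<le> W powr e"
        using x0 x \<rho> that by (intro powr_mono2) (auto simp: W_def le_max_iff_disj frac_le)
      also have "\<dots> \<le> P" unfolding P_def using that by (intro powr_mono) (auto simp: W_def)
      finally show ?thesis .
    qed
    have Pa: "x powr - \<alpha> \<le> P" "x powr - \<beta> \<le> P"
      using \<alpha> A \<beta> by (auto intro!: P simp: abs_le_iff)
    have ln: "\<bar>ln x\<bar> \<le> \<Lambda>"
      using x \<rho> ln_mono[of \<rho>\<^sub>0 x] ln_mono[of x \<rho>\<^sub>1] unfolding \<Lambda>_def by linarith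
    have "\<bar>x powr - \<alpha> - x powr - \<beta>\<bar> \<le> P * \<bar>ln x\<bar> * \<bar>\<beta> - \<alpha>\<bar>"
      using powr_exponent_lipschitz[OF x0 Pa] by simp
    also have "\<dots> \<le> P * \<Lambda> * \<bar>\<beta> - \<alpha>\<bar>"
      using P0 ln by (intro mult_right_mono mult_left_mono) auto
    finally have lip: "\<bar>x powr - \<alpha> - x powr - \<beta>\<bar> \<le> P * \<Lambda> * \<bar>\<beta> - \<alpha>\<bar>" .
    \<comment> \<open>Replace \<open>w\<close> by \<open>y\<close>, then the exponent, then
      \<open>y\<close> by \<open>h\<close>.\<close>
    have "x powr - \<alpha> * w - x powr - \<beta> * h =
        x powr - \<alpha> * (w - y) + (x powr - \<alpha> - x powr - \<beta>) * y - x powr - \<beta> * (h - y)"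
      by (simp add: algebra_simps)
    then have "\<bar>x powr - \<alpha> * w - x powr - \<beta> * h\<bar> \<le>
        \<bar>x powr - \<alpha> * (w - y)\<bar> + \<bar>(x powr - \<alpha> - x powr - \<beta>) * y\<bar> + \<bar>x powr - \<beta> * (h - y)\<bar>"
      by linarith
    also have "\<dots> \<le> P * \<bar>w - y\<bar> + P * \<Lambda> * \<bar>\<beta> - \<alpha>\<bar> * b + P * \<bar>h - y\<bar>"
      using Pa P0 \<Lambda>0 lip y b unfolding abs_mult by (intro add_mono mult_mono) auto
    also have "\<dots> \<le> P * (1 + \<Lambda> * b) * (\<bar>w - y\<bar> + \<bar>h - y\<bar> + \<bar>\<beta> - \<alpha>\<bar>)"
    proof -
      have "0 \<le> P * \<bar>\<beta> - \<alpha>\<bar> + P * \<Lambda> * b * (\<bar>w - y\<bar> + \<bar>h - y\<bar>)"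
        using P0 \<Lambda>0 b by simp
      then show ?thesis by (simp add: algebra_simps)
    qed
    finally show ?thesis .
  qed
  moreover have "0 < P * (1 + \<Lambda> * b)" using P0 \<Lambda>0 b by (simp add: add_pos_nonneg)
  ultimately show ?thesis using that by blast
qed

lemma argmax_setD:
  fixes g :: "'a \<Rightarrow> real"
  assumes "z \<in> argmax_set g A"
  shows "z \<in> A" "w \<in> A \<Longrightarrow> g w \<le> g z"
  using assms by (auto simp: argmax_set_def is_arg_max_def not_less[symmetric])

text \<open>Only the comparison \<open>H y \<le> H z\<close> of the perturbed objective enters, so \<open>H\<close> may be any
  positive multiple of it.\<close>

lemma argmax_stability:
  fixes \<Psi> H :: "'a::euclidean_space \<Rightarrow> real"
  assumes y: "y \<in> argmax_set \<Psi> \<Gamma>" "y \<in> KJ" and z: "z \<in> \<Gamma>" "z \<in> KJ" and H: "H y \<le> H z"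
    and close: "\<And>x. x \<in> KJ \<Longrightarrow> \<bar>\<Psi> x - H x\<bar> \<le> e"
    and diam: "dist z y \<le> D"
    and c: "0 < c" and \<kappa>: "0 < \<kappa>" and \<delta>: "0 < \<delta>\<^sub>0"
    and ident: "(SUP w\<in>\<Gamma>. \<Psi> w) - \<Psi> z \<ge> c * min (infdist z (argmax_set \<Psi> \<Gamma>)) \<delta>\<^sub>0 powr \<kappa>"
  shows "infdist z (argmax_set \<Psi> \<Gamma>) \<le> max 1 (D / \<delta>\<^sub>0) * (2 * e / c) powr (1 / \<kappa>)"
proof -
  define d where "d = infdist z (argmax_set \<Psi> \<Gamma>)"
  define m where "m = min d \<delta>\<^sub>0"
  have d: "0 \<le> d" "d \<le> D" using infdist_le[OF y(1), of z] diam by (auto simp: d_def infdist_nonneg)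
  have m: "0 \<le> m" using d \<delta> by (simp add: m_def)
  \<comment> \<open>The maximum is attained, so the real supremum is the value at \<open>y\<close>.
    The gap at \<open>z\<close> is at most \<open>2 * e\<close>, since each of the two points costs
    one \<open>e\<close> when passing to \<open>H\<close>.\<close>
  have "(SUP w\<in>\<Gamma>. \<Psi> w) = \<Psi> y"
    using argmax_setD[OF y(1)] by (intro cSup_eq_maximum) auto
  then have "c * m powr \<kappa> \<le> \<Psi> y - \<Psi> z" using ident by (simp add: m_def d_def)
  also have "\<dots> \<le> 2 * e" using close[OF y(2)] close[OF z(2)] H by (simp add: abs_le_iff)
  finally have "m powr \<kappa> \<le> 2 * e / c" using c by (simp add: field_simps)
  then have "(m powr \<kappa>) powr (1 / \<kappa>) \<le> (2 * e / c) powr (1 / \<kappa>)"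
    using \<kappa> by (intro powr_mono2) auto
  then have m_le: "m \<le> (2 * e / c) powr (1 / \<kappa>)"
    using \<kappa> m by (simp add: powr_powr)
  \<comment> \<open>Where the truncation is active, \<open>m\<close> equals
    \<open>\<delta>\<^sub>0\<close> while \<open>d\<close> is at most \<open>D\<close>, so the loss
    is a factor \<open>D / \<delta>\<^sub>0\<close>.\<close>
  have "d \<le> max 1 (D / \<delta>\<^sub>0) * m"
  proof (cases "d \<le> \<delta>\<^sub>0")
    case True
    then show ?thesis using d mult_right_mono[of 1 "max 1 (D / \<delta>\<^sub>0)" d] by (simp add: m_def)
  next
    case False
    then have "d \<le> D / \<delta>\<^sub>0 * m" using d \<delta> by (simp add: m_def)
    also have "\<dots> \<le> max 1 (D / \<delta>\<^sub>0) * m" using m by (intro mult_right_mono) auto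
    finally show ?thesis .
  qed
  also have "\<dots> \<le> max 1 (D / \<delta>\<^sub>0) * (2 * e / c) powr (1 / \<kappa>)"
    using m_le by (intro mult_left_mono) auto
  finally show ?thesis by (simp add: d_def)
qed

lemma compact_away_from_0:
  fixes A :: "'a::euclidean_space set"
  assumes "compact A" "0 \<notin> A"
  obtains \<rho>\<^sub>0 \<rho>\<^sub>1 where "0 < \<rho>\<^sub>0" "0 < \<rho>\<^sub>1" "\<And>z. z \<in> A \<Longrightarrow> \<rho>\<^sub>0 \<le> norm z" "\<And>z. z \<in> A \<Longrightarrow> norm z \<le> \<rho>\<^sub>1"
proof -
  obtain \<rho>\<^sub>1 where "0 < \<rho>\<^sub>1" "\<And>z. z \<in> A \<Longrightarrow> norm z \<le> \<rho>\<^sub>1"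
    using compact_imp_bounded[OF assms(1)] by (auto simp: bounded_pos)
  moreover have "open (- A)" using assms by (simp add: compact_imp_closed open_Compl)
  then obtain \<rho>\<^sub>0 where "0 < \<rho>\<^sub>0" "ball 0 \<rho>\<^sub>0 \<subseteq> - A"
    using assms(2) openE[of "- A" 0] by auto
  then have "\<rho>\<^sub>0 \<le> norm z" if "z \<in> A" for z using that by (force simp: not_less[symmetric])
  ultimately show ?thesis using that \<open>0 < \<rho>\<^sub>0\<close> by blast
qed

text \<open>The point \<open>u *\<^sub>R z\<close> has radius \<open>u * norm z\<close>, beyond
  \<open>t\<close>, so the polar formula applies. Collecting powers of \<open>u\<close> isolates a
  scalar factor independent of \<open>z\<close>.\<close>

lemma ssgen_objective:
  fixes g :: "'a::euclidean_space \<Rightarrow> real"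
  assumes Q: "ssgen_law E t p \<sigma> \<phi> Q g" and "cone E" "z \<in> E" "0 < t" "t < u * norm z" "0 < u"
  shows "u powr (s + real DIM('a)) * g (u *\<^sub>R z) =
    p * \<sigma> * t powr \<sigma> * u powr (s - \<sigma>) * (norm z powr - (\<sigma> + real DIM('a)) * \<phi> (z /\<^sub>R norm z))"
proof -
  have z: "0 < norm z" using assms by (metis mult_zero_right norm_eq_zero norm_ge_zero less_le less_asym)
  have "z /\<^sub>R norm z \<in> unit_dirs E"
    using z mem_cone[OF assms(2,3), of "inverse (norm z)"] by (auto simp: unit_dirs_def)
  moreover have "u *\<^sub>R z = (u * norm z) *\<^sub>R (z /\<^sub>R norm z)" using z by simp
  ultimately have "g (u *\<^sub>R z) = (u * norm z) powr (- (real DIM('a) - 1)) * p * \<sigma> * t powr \<sigma>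
      * (u * norm z) powr (- (\<sigma> + 1)) * \<phi> (z /\<^sub>R norm z)"
    using Q assms(5) unfolding ssgen_law_def by metis
  also have "\<dots> = p * \<sigma> * t powr \<sigma> * ((u * norm z) powr (- (real DIM('a) - 1)) * (u * norm z) powr (- (\<sigma> + 1)))
      * \<phi> (z /\<^sub>R norm z)" by (simp only: mult_ac)
  also have "(u * norm z) powr (- (real DIM('a) - 1)) * (u * norm z) powr (- (\<sigma> + 1)) = 
      (u * norm z) powr - (\<sigma> + real DIM('a))"
    by (simp add: algebra_simps flip: powr_add)
  also have "\<dots> = u powr - (\<sigma> + real DIM('a)) * norm z powr - (\<sigma> + real DIM('a))"
    using z assms(6) by (simp add: powr_mult)
  finally have "u powr (s + real DIM('a)) * g (u *\<^sub>R z) = 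
      p * \<sigma> * t powr \<sigma> * (u powr (s + real DIM('a)) * u powr - (\<sigma> + real DIM('a)))
       * (norm z powr - (\<sigma> + real DIM('a)) * \<phi> (z /\<^sub>R norm z))"
    by (simp only: mult_ac)
  also have "u powr (s + real DIM('a)) * u powr - (\<sigma> + real DIM('a)) = u powr (s - \<sigma>)"
    by (simp flip: powr_add)
  finally show ?thesis .
qed

section \<open>The localization rate\<close>

theorem theorem4:
  fixes M :: "'w measure"
    and E :: "'a::euclidean_space set"
    and \<xi> :: "nat \<Rightarrow> 'w \<Rightarrow> 'a"
    and f \<phi>star :: "'a \<Rightarrow> real"
    and L Lstar :: "nat \<Rightarrow> 'a \<Rightarrow> real"
    and K :: nat and JJ :: "nat set set" and J :: "nat set"
    and s \<gamma> q r m l c \<kappa> \<delta>\<^sub>0 :: real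
    and k :: "nat \<Rightarrow> nat" and u :: "nat \<Rightarrow> real" and t :: "nat \<Rightarrow> 'w \<Rightarrow> real"
    and s_est :: "nat \<Rightarrow> 'a list \<Rightarrow> real" and \<phi>_est :: "nat \<Rightarrow> 'a list \<Rightarrow> 'a \<Rightarrow> real"
    and s_hat :: "nat \<Rightarrow> 'w \<Rightarrow> real" and \<phi>_hat :: "nat \<Rightarrow> 'w \<Rightarrow> 'a \<Rightarrow> real"
    and P_gen :: "nat \<Rightarrow> 'w \<Rightarrow> 'a measure" and f_gen :: "nat \<Rightarrow> 'w \<Rightarrow> 'a \<Rightarrow> real"
    and \<Gamma> :: "nat \<Rightarrow> 'a set"
    and \<Psi> :: "nat \<Rightarrow> 'a \<Rightarrow> real" and \<Psi>_hat :: "nat \<Rightarrow> 'w \<Rightarrow> 'a \<Rightarrow> real"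
    and Y :: "nat \<Rightarrow> 'a set" and Y_hat :: "nat \<Rightarrow> 'w \<Rightarrow> 'a set"
    and KJ :: "'a set" and a :: "nat \<Rightarrow> 'w \<Rightarrow> real"
  assumes M: "prob_space M"
    and E: "closed E" "cone E"
    \<comment> \<open>the i.i.d. sample\<close>
    and f: "density_on_cone E f"
    and iid: "prob_space.indep_vars M (\<lambda>_. borel) \<xi> UNIV"
             "\<And>i. distributed M lborel (\<xi> i) (\<lambda>z. ennreal (f z))"
    and rv: "density_regularly_varying E f s \<phi>star"
    and second_order: "second_order_condition E f s \<phi>star \<gamma>"
    \<comment> \<open>the loss system\<close>
    and H1: "asymp_homogeneous_system E K L Lstar"
    and JJ: "JJ \<subseteq> Pow {1..K} - {{}}"
    and regular: "regular_system E Lstar JJ"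
    and J: "J \<in> JJ"
    \<comment> \<open>thresholds\<close>
    and q: "0 < q" "q < 1"
    and r: "1 \<le> r"
    and k_def: "\<And>n. k n = nat \<lfloor>real n powr (1 - q)\<rfloor>"
    and t_def: "\<And>n \<omega>. t n \<omega> = kth_largest (k n) (radii \<xi> n \<omega>)"
    and u_def: "\<And>n. u n = quantile (distr (law_of_density f) borel norm) (1 - real n powr (- r))"
    \<comment> \<open>estimators and their rates\<close>
    and s_hat_def: "\<And>n \<omega>. s_hat n \<omega> = s_est n (exceedances \<xi> n (t n \<omega>) \<omega>)"
    and \<phi>_hat_def: "\<And>n \<omega>. \<phi>_hat n \<omega> = \<phi>_est n (exceedances \<xi> n (t n \<omega>) \<omega>)"
    and s_hat_measurable: "\<And>n. n \<ge> 1 \<Longrightarrow> s_hat n \<in> borel_measurable M"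
    and \<phi>_hat_measurable:
      "\<And>n \<theta>. n \<ge> 1 \<Longrightarrow> \<theta> \<in> unit_dirs E \<Longrightarrow> (\<lambda>\<omega>. \<phi>_hat n \<omega> \<theta>) \<in> borel_measurable M"
    and s_hat_pos: "\<And>n \<omega>. n \<ge> 1 \<Longrightarrow> \<omega> \<in> space M \<Longrightarrow> s_hat n \<omega> > 0"
    and \<phi>_hat_density: "\<And>n \<omega>. n \<ge> 1 \<Longrightarrow> \<omega> \<in> space M \<Longrightarrow> angular_prob_density E (\<phi>_hat n \<omega>)"
    and m: "0 < m" "m \<le> 1/2"
    and l: "0 < l" "l \<le> 1/2"
    and s_hat_rate: "big_O_P M (\<lambda>n \<omega>. ennreal \<bar>s_hat n \<omega> - s\<bar>) (\<lambda>n \<omega>. real (k n) powr (- m))"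
    and \<phi>_hat_rate:
      "big_O_P M
         (\<lambda>n \<omega>. angular_sup_norm E (\<lambda>\<theta>. \<phi>_hat n \<omega> \<theta> - cond_angular_density f (t n \<omega>) \<theta>))
         (\<lambda>n \<omega>. real (k n) powr (- l))"
    \<comment> \<open>the generative law\<close>
    and P_gen: "\<And>n \<omega>. n \<ge> 1 \<Longrightarrow> \<omega> \<in> space M \<Longrightarrow>
      ssgen_law E (t n \<omega>) (real (k n) / real n) (s_hat n \<omega>) (\<phi>_hat n \<omega>) (P_gen n \<omega>) (f_gen n \<omega>)"
    \<comment> \<open>the reverse-stress problems\<close>
    and \<Gamma>_def: "\<And>n. \<Gamma> n = scaled_stress_set E L (u n) J"
    and \<Psi>_def: "\<And>n z. \<Psi> n z = u n powr (s + real DIM('a)) * f (u n *\<^sub>R z)"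
    and \<Psi>_hat_def: "\<And>n \<omega> z. \<Psi>_hat n \<omega> z = u n powr (s + real DIM('a)) * f_gen n \<omega> (u n *\<^sub>R z)"
    and Y_def: "\<And>n. Y n = argmax_set (\<Psi> n) (\<Gamma> n)"
    and Y_hat_def: "\<And>n \<omega>. Y_hat n \<omega> = argmax_set (\<Psi>_hat n \<omega>) (\<Gamma> n)"
    and attained: "\<forall>\<^sub>F n in sequentially. Y n \<noteq> {}"
    and attained_hat: "with_prob_tending_to_one M (\<lambda>n \<omega>. Y_hat n \<omega> \<noteq> {})"
    \<comment> \<open>localization and local identifiability\<close>
    and KJ: "compact KJ" "KJ \<subseteq> E - {0}"
    and Y_localized: "\<forall>\<^sub>F n in sequentially. Y n \<subseteq> KJ"
    and Y_hat_localized: "with_prob_tending_to_one M (\<lambda>n \<omega>. Y_hat n \<omega> \<subseteq> KJ)"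
    and ident_constants: "c > 0" "\<kappa> \<ge> 1" "\<delta>\<^sub>0 > 0"
    and identifiability:
      "\<forall>\<^sub>F n in sequentially. \<forall>z \<in> \<Gamma> n \<inter> KJ.
         (SUP w\<in>\<Gamma> n. \<Psi> n w) - \<Psi> n z \<ge> c * min (infdist z (Y n)) \<delta>\<^sub>0 powr \<kappa>"
    \<comment> \<open>the rate\<close>
    and a_def: "\<And>n \<omega>. a n \<omega> =
      real (k n) powr (- l) + real (k n) powr (- m) * ln (u n / t n \<omega>) + t n \<omega> powr (- \<gamma>)"
  shows "big_O_P M (\<lambda>n \<omega>. SUP z\<in>Y_hat n \<omega>. ennreal (infdist z (Y n))) (\<lambda>n \<omega>. a n \<omega> powr (1 / \<kappa>))
    \<and> (\<forall>z_star :: nat \<Rightarrow> 'a. (\<forall>\<^sub>F n in sequentially. Y n = {z_star n}) \<longrightarrow>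
         (\<forall>z_hat :: nat \<Rightarrow> 'w \<Rightarrow> 'a. with_prob_tending_to_one M (\<lambda>n \<omega>. z_hat n \<omega> \<in> Y_hat n \<omega>) \<longrightarrow>
            big_O_P M (\<lambda>n \<omega>. ennreal (norm (z_hat n \<omega> - z_star n))) (\<lambda>n \<omega>. a n \<omega> powr (1 / \<kappa>))))"
proof (intro conjI allI impI)
  interpret prob_space M by (rule M)
  have s: "0 < s" using rv by (simp add: density_regularly_varying_def)
  obtain T C\<^sub>0 b\<^sub>1 b\<^sub>2 where T: "1 \<le> T" and C0: "0 < C\<^sub>0" and b: "0 < b\<^sub>1" "0 < b\<^sub>2"
    and \<phi>star: "\<And>\<theta>. \<theta> \<in> unit_dirs E \<Longrightarrow> 0 \<le> \<phi>star \<theta>" "\<And>\<theta>. \<theta> \<in> unit_dirs E \<Longrightarrow> \<phi>star \<theta> \<le> b\<^sub>2"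
    and approx: "\<And>t r \<theta>. T \<le> t \<Longrightarrow> t < r \<Longrightarrow> \<theta> \<in> unit_dirs E \<Longrightarrow>
      \<bar>r powr (s + real DIM('a)) * f (r *\<^sub>R \<theta>) - \<phi>star \<theta>\<bar> \<le> C\<^sub>0 * t powr - \<gamma>"
    and f_lo: "\<And>z. z \<in> E \<Longrightarrow> T < norm z \<Longrightarrow> b\<^sub>1 * norm z powr - (s + real DIM('a)) \<le> f z"
    and f_up: "\<And>z. z \<in> E \<Longrightarrow> T < norm z \<Longrightarrow> f z \<le> b\<^sub>2 * norm z powr - (s + real DIM('a))"
    using second_order_tail_bounds[OF E rv second_order] by blast
  define p where "p = (\<lambda>x. measure (law_of_density f) {z. x < norm z})"
  have "0 < T" using T by simp
  obtain c\<^sub>1 c\<^sub>2 where c12: "0 < c\<^sub>1" "0 < c\<^sub>2" 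
    and p_lo: "\<And>x. T \<le> x \<Longrightarrow> c\<^sub>1 * x powr - s \<le> p x" and p_up: "\<And>x. T \<le> x \<Longrightarrow> p x \<le> c\<^sub>2 * x powr - s"
    unfolding p_def using tail_prob_bounds[OF E f \<open>0 < T\<close> b(1) f_lo f_up] by blast
  have p_pos: "0 < p x" if "T \<le> x" for x
  proof -
    have "0 < c\<^sub>1 * x powr - s" using c12 that T by simp
    then show ?thesis using p_lo[OF that] by linarith
  qed
  have k_bounds: "1 \<le> k n" "k n \<le> n" if "1 \<le> n" for n
    unfolding k_def using nat_floor_powr_bounds[OF q that] by blast+
  obtain \<rho>\<^sub>0 \<rho>\<^sub>1 where \<rho>: "0 < \<rho>\<^sub>0" "0 < \<rho>\<^sub>1" "\<And>z. z \<in> KJ \<Longrightarrow> \<rho>\<^sub>0 \<le> norm z" "\<And>z. z \<in> KJ \<Longrightarrow> norm z \<le> \<rho>\<^sub>1"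
    using compact_away_from_0[OF KJ(1)] KJ(2) by blast
  \<comment> \<open>Being below \<open>\<rho>\<^sub>0\<close>, this ratio keeps the rescaled
    localization set outside radius t_n; being at most 1/e, it makes the logarithm in the rate at
    least one.\<close>
  define \<eta> where "\<eta> = min (\<rho>\<^sub>0 / 2) (exp (- 1))"
  have \<eta>: "0 < \<eta>" "\<eta> \<le> exp (- 1)" "\<eta> < \<rho>\<^sub>0" using \<rho>(1) by (auto simp: \<eta>_def min_less_iff_disj)

  \<comment> \<open>The event on which the thresholds are well separated\<close>
  have k_frac: "(\<lambda>n. real (k n) / real n) \<longlonglongrightarrow> 0"
  proof (rule tendsto_sandwich[OF _ _ tendsto_const])
    show "(\<lambda>n. real n powr - q) \<longlonglongrightarrow> 0" using q by real_asymp
    show "\<forall>\<^sub>F n in sequentially. real (k n) / real n \<le> real n powr - q"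
      using eventually_ge_at_top[of 1]
    proof eventually_elim
      case (elim n)
      have "real (k n) \<le> real n powr (1 - q)"
        unfolding k_def by (rule nat_floor_powr_bounds[OF q elim])
      also have "\<dots> = real n * real n powr - q"
        using elim by (simp add: powr_diff powr_minus divide_inverse)
      finally show ?case using elim by (simp add: field_simps)
    qed
  qed simp
  have ev_k: "\<forall>\<^sub>F n in sequentially. 1 \<le> k n \<and> k n \<le> n"
    using eventually_ge_at_top[of 1] by eventually_elim (use k_bounds in blast)
  have t_large: "with_prob_tending_to_one M (\<lambda>n \<omega>. T < t n \<omega>)"
    unfolding t_def using p_pos[of T] unfolding p_def
    by (intro kth_largest_tends_to_infinity[OF iid(2,1) ev_k k_frac]) simp
  have t_small: "with_prob_tending_to_one M (\<lambda>n \<omega>. t n \<omega> \<le> \<eta> * u n)"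
    unfolding t_def u_def
    using intermediate_below_extreme[OF f s q r T c12 p_lo[unfolded p_def] p_up[unfolded p_def] \<eta>(1)]
    by (intro kth_largest_below[OF iid(2) ev_k]) (simp add: k_def)
  have good: "with_prob_tending_to_one M (\<lambda>n \<omega>. T < t n \<omega> \<and> t n \<omega> \<le> \<eta> * u n \<and> Y_hat n \<omega> \<subseteq> KJ)"
    by (intro with_prob_tending_to_one_conj t_large t_small Y_hat_localized)

  \<comment> \<open>The rate for the whole maximizer set\<close>
  show main: "big_O_P M (\<lambda>n \<omega>. SUP z\<in>Y_hat n \<omega>. ennreal (infdist z (Y n))) (\<lambda>n \<omega>. a n \<omega> powr (1 / \<kappa>))"
  proof (rule big_O_P_combine[OF s_hat_rate \<phi>_hat_rate good])
    fix C\<^sub>1 C\<^sub>2 :: real assume C12: "0 < C\<^sub>1" "0 < C\<^sub>2"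
    obtain B where B: "0 < B" "\<And>x \<beta> w h y. \<rho>\<^sub>0 \<le> x \<Longrightarrow> x \<le> \<rho>\<^sub>1 \<Longrightarrow> 0 \<le> \<beta> \<Longrightarrow> \<bar>\<beta> - (s + real DIM('a))\<bar> \<le> C\<^sub>1 \<Longrightarrow>
        0 \<le> y \<Longrightarrow> y \<le> b\<^sub>2 \<Longrightarrow> \<bar>x powr - (s + real DIM('a)) * w - x powr - \<beta> * h\<bar>
          \<le> B * (\<bar>w - y\<bar> + \<bar>h - y\<bar> + \<bar>\<beta> - (s + real DIM('a))\<bar>)"
    proof (rule radial_perturbation[of "s + real DIM('a)" C\<^sub>1 b\<^sub>2 \<rho>\<^sub>0 \<rho>\<^sub>1])
    qed (use s C12 b \<rho> in auto)
    \<comment> \<open>The terms come from the second-order error, occurring once in the density and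
      once in the angular part, from the angular estimate, and from the index estimate.\<close>
    define B' where "B' = B * (2 * C\<^sub>0 + s * c\<^sub>2 * C\<^sub>2 + C\<^sub>1)"
    have B': "0 < B'" using B C0 s c12 C12 by (auto simp: B'_def intro!: mult_pos_pos add_pos_pos)
    \<comment> \<open>This is the constant of \<open>argmax_stability\<close> with diameter bound
      \<open>2 * \<rho>\<^sub>1\<close>.\<close>
    define C where "C = max 1 (2 * \<rho>\<^sub>1 / \<delta>\<^sub>0) * (2 * B' / c) powr (1 / \<kappa>)"
    have "0 < C" using B' ident_constants by (simp add: C_def)
    moreover have "\<forall>\<^sub>F n in sequentially. \<forall>\<omega>\<in>space M.
        T < t n \<omega> \<and> t n \<omega> \<le> \<eta> * u n \<and> Y_hat n \<omega> \<subseteq> KJ \<longrightarrow>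
        ennreal \<bar>s_hat n \<omega> - s\<bar> \<le> ennreal (C\<^sub>1 * real (k n) powr - m) \<longrightarrow>
        angular_sup_norm E (\<lambda>\<theta>. \<phi>_hat n \<omega> \<theta> - cond_angular_density f (t n \<omega>) \<theta>)
          \<le> ennreal (C\<^sub>2 * real (k n) powr - l) \<longrightarrow>
        (SUP z\<in>Y_hat n \<omega>. ennreal (infdist z (Y n))) \<le> ennreal (C * a n \<omega> powr (1 / \<kappa>))"
      using attained Y_localized identifiability eventually_ge_at_top[of 1]
    proof (eventually_elim, intro ballI impI, elim conjE)
      fix n \<omega>
      assume Y_ne: "Y n \<noteq> {}" and Y_KJ: "Y n \<subseteq> KJ"
        and ident: "\<forall>z\<in>\<Gamma> n \<inter> KJ. c * min (infdist z (Y n)) \<delta>\<^sub>0 powr \<kappa> \<le> (SUP w\<in>\<Gamma> n. \<Psi> n w) - \<Psi> n z"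
        and n: "1 \<le> n" and \<omega>: "\<omega> \<in> space M"
        and s_close: "ennreal \<bar>s_hat n \<omega> - s\<bar> \<le> ennreal (C\<^sub>1 * real (k n) powr - m)"
        and \<phi>_close: "angular_sup_norm E (\<lambda>\<theta>. \<phi>_hat n \<omega> \<theta> - cond_angular_density f (t n \<omega>) \<theta>)
          \<le> ennreal (C\<^sub>2 * real (k n) powr - l)"
        and t_gt: "T < t n \<omega>" and t_le: "t n \<omega> \<le> \<eta> * u n" and Yh_KJ: "Y_hat n \<omega> \<subseteq> KJ"
      define \<tau> where "\<tau> = t n \<omega>"
      define \<sigma> where "\<sigma> = s_hat n \<omega>"
      \<comment> \<open>The rate without its logarithm is the one at which the objectives are
        compared.\<close>
      define a' where "a' = real (k n) powr - l + real (k n) powr - m + \<tau> powr - \<gamma>"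
      define H where "H = (\<lambda>z. norm z powr - (\<sigma> + real DIM('a)) * (s * \<tau> powr s * p \<tau> * \<phi>_hat n \<omega> (z /\<^sub>R norm z)))"
      have \<tau>: "T < \<tau>" "0 < \<tau>" "\<tau> \<le> \<eta> * u n" using t_gt t_le T by (auto simp: \<tau>_def)
      have u: "0 < u n" using \<tau> \<eta> by (metis less_le_trans zero_less_mult_pos)
      have \<sigma>: "0 < \<sigma>" using s_hat_pos n \<omega> by (simp add: \<sigma>_def)
      have k: "1 \<le> real (k n)" using k_bounds[OF n] by simp
      have "\<bar>\<sigma> - s\<bar> \<le> C\<^sub>1 * real (k n) powr - m"
        using s_close C12 by (simp add: \<sigma>_def)
      \<comment> \<open>This keeps the estimated exponent within \<open>C\<^sub>1\<close> of the
        true one, so the constant \<open>B\<close> serves all \<open>n\<close>.\<close>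
      moreover have "real (k n) powr - m \<le> 1"
        using k m by (simp add: powr_le_one_le powr_minus inverse_le_1_iff ge_one_powr_ge_zero)
      then have "C\<^sub>1 * real (k n) powr - m \<le> C\<^sub>1 * 1" using C12 by (intro mult_left_mono) auto
      ultimately have \<sigma>_close: "\<bar>\<sigma> - s\<bar> \<le> C\<^sub>1 * real (k n) powr - m" "\<bar>\<sigma> - s\<bar> \<le> C\<^sub>1"
        by linarith+
      have \<phi>_close': "\<bar>\<phi>_hat n \<omega> \<theta> - cond_angular_density f \<tau> \<theta>\<bar> \<le> C\<^sub>2 * real (k n) powr - l"
        if "\<theta> \<in> unit_dirs E" for \<theta>
        using order_trans[OF SUP_upper[OF that] \<phi>_close[unfolded angular_sup_norm_def]] C12
        by (simp add: \<tau>_def)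
      \<comment> \<open>The factor multiplying the angular estimate in \<open>H\<close> stays
        bounded, so the estimation error is not magnified.\<close>
      have scale: "\<tau> powr s * p \<tau> \<le> c\<^sub>2"
      proof -
        have "\<tau> powr s * p \<tau> \<le> \<tau> powr s * (c\<^sub>2 * \<tau> powr - s)"
          using \<tau> by (intro mult_left_mono p_up) auto
        also have "\<dots> = c\<^sub>2" using \<tau> by (simp add: powr_minus)
        finally show ?thesis .
      qed
      have outside: "\<tau> < u n * norm z" if "z \<in> KJ" for z
      proof -
        have "\<tau> \<le> \<eta> * u n" by (rule \<tau>)
        also have "\<dots> < \<rho>\<^sub>0 * u n" using \<eta> u by simp
        also have "\<dots> \<le> norm z * u n" using \<rho>(3)[OF that] u by simp
        finally show ?thesis by (simp add: mult.commute)
      qed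
      have close: "\<bar>\<Psi> n z - H z\<bar> \<le> B' * a'" if z: "z \<in> KJ" for z
      proof -
        define \<theta> where "\<theta> = z /\<^sub>R norm z"
        have z0: "0 < norm z" "z \<in> E" using z KJ by auto
        have \<theta>: "\<theta> \<in> unit_dirs E" "norm z *\<^sub>R \<theta> = z"
          using z0 mem_cone[OF E(2), of z "inverse (norm z)"] by (auto simp: \<theta>_def unit_dirs_def)
        define w where "w = (u n * norm z) powr (s + real DIM('a)) * f ((u n * norm z) *\<^sub>R \<theta>)"
        define h where "h = s * \<tau> powr s * p \<tau> * \<phi>_hat n \<omega> \<theta>"
        have w: "\<bar>w - \<phi>star \<theta>\<bar> \<le> C\<^sub>0 * \<tau> powr - \<gamma>"
          unfolding w_def using \<tau> outside[OF z] \<theta> by (intro approx) auto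
        have "\<bar>s * \<tau> powr s * p \<tau> * cond_angular_density f \<tau> \<theta> - \<phi>star \<theta>\<bar> \<le> C\<^sub>0 * \<tau> powr - \<gamma>"
          unfolding p_def using \<tau> \<theta> p_pos[of \<tau>]
          by (intro cond_angular_density_approx[OF f s] approx) (auto simp: p_def)
        moreover have "\<bar>h - s * \<tau> powr s * p \<tau> * cond_angular_density f \<tau> \<theta>\<bar> \<le> s * c\<^sub>2 * (C\<^sub>2 * real (k n) powr - l)"
        proof -
          have "\<bar>h - s * \<tau> powr s * p \<tau> * cond_angular_density f \<tau> \<theta>\<bar> =
              s * (\<tau> powr s * p \<tau>) * \<bar>\<phi>_hat n \<omega> \<theta> - cond_angular_density f \<tau> \<theta>\<bar>"
            using s by (simp add: h_def p_def abs_mult mult.assoc flip: right_diff_distrib)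
          also have "\<dots> \<le> s * c\<^sub>2 * (C\<^sub>2 * real (k n) powr - l)"
            using s c12 scale \<phi>_close'[OF \<theta>(1)] by (intro mult_mono mult_left_mono) auto
          finally show ?thesis .
        qed
        ultimately have h: "\<bar>h - \<phi>star \<theta>\<bar> \<le> C\<^sub>0 * \<tau> powr - \<gamma> + s * c\<^sub>2 * (C\<^sub>2 * real (k n) powr - l)"
          by linarith
        \<comment> \<open>Splitting off the radial factor leaves the density normalized at its
          actual radius \<open>u n * norm z\<close>, where the second-order bound applies.\<close>
        have "\<Psi> n z = norm z powr - (s + real DIM('a)) * w"
        proof -
          have "norm z powr - e * (u n * norm z) powr e = u n powr e" for e
            using u z0 by (simp add: powr_mult powr_minus)
          moreover have "(u n * norm z) *\<^sub>R \<theta> = u n *\<^sub>R z"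
            using \<theta>(2) by (simp flip: scaleR_scaleR)
          ultimately show ?thesis
            unfolding \<Psi>_def w_def by (metis mult.assoc)
        qed
        moreover have "H z = norm z powr - (\<sigma> + real DIM('a)) * h"
          by (simp add: H_def h_def \<theta>_def)
        ultimately have "\<bar>\<Psi> n z - H z\<bar> \<le> B * (\<bar>w - \<phi>star \<theta>\<bar> + \<bar>h - \<phi>star \<theta>\<bar> + \<bar>\<sigma> + real DIM('a) - (s + real DIM('a))\<bar>)"
          using \<rho>(3,4)[OF z] \<sigma> \<sigma>_close \<phi>star[OF \<theta>(1)] by (simp only:) (intro B(2), auto)
        also have "\<dots> \<le> B * (2 * C\<^sub>0 * \<tau> powr - \<gamma> + s * c\<^sub>2 * C\<^sub>2 * real (k n) powr - l + C\<^sub>1 * real (k n) powr - m)"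
          using w h \<sigma>_close B by (intro mult_left_mono) (auto simp: mult.assoc)
        \<comment> \<open>Each coefficient is enlarged to the common sum, so that the three rates
          add up to \<open>a'\<close>.\<close>
        also have "\<dots> \<le> B * ((2 * C\<^sub>0 + s * c\<^sub>2 * C\<^sub>2 + C\<^sub>1) * \<tau> powr - \<gamma> + (2 * C\<^sub>0 + s * c\<^sub>2 * C\<^sub>2 + C\<^sub>1) * real (k n) powr - l + (2 * C\<^sub>0 + s * c\<^sub>2 * C\<^sub>2 + C\<^sub>1) * real (k n) powr - m)"
          using B C0 s c12 C12 by (intro mult_left_mono add_mono mult_right_mono) auto
        also have "\<dots> = B' * a'" by (simp add: B'_def a'_def algebra_simps)
        finally show ?thesis .
      qed
      \<comment> \<open>A ratio \<open>u n / \<tau>\<close> of at least e makes the logarithm at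
        least one, so \<open>a'\<close> is bounded by the stated rate.\<close>
      have "\<tau> \<le> exp (- 1) * u n"
        using \<tau>(3) mult_right_mono[OF \<eta>(2), of "u n"] u by linarith
      then have "exp 1 * \<tau> \<le> u n"
        by (simp add: exp_minus divide_simps mult.commute)
      then have "exp 1 \<le> u n / \<tau>"
        using \<tau>(2) by (simp add: pos_le_divide_eq)
      then have "1 \<le> ln (u n / \<tau>)"
        using u \<tau> by (subst ln_ge_iff) auto
      then have a': "a' \<le> a n \<omega>" "0 \<le> a'"
        using mult_left_mono[of 1 "ln (u n / \<tau>)" "real (k n) powr - m"] by (auto simp: a'_def a_def \<tau>_def)
      obtain y where y: "y \<in> Y n" using Y_ne by blast
      have "infdist z (Y n) \<le> C * a n \<omega> powr (1 / \<kappa>)" if z: "z \<in> Y_hat n \<omega>" for z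
      proof -
        have zy: "z \<in> KJ" "y \<in> KJ" "z \<in> \<Gamma> n" "y \<in> \<Gamma> n"
          using z y Y_KJ Yh_KJ by (auto simp: Y_def Y_hat_def dest: argmax_setD(1))
        define F where "F = (\<lambda>z. norm z powr - (\<sigma> + real DIM('a)) * \<phi>_hat n \<omega> (z /\<^sub>R norm z))"
        \<comment> \<open>The order of objective values at \<open>y\<close> and \<open>z\<close>
          passes from \<open>\<Psi>_hat\<close> to \<open>F\<close> on division by
          \<open>\<beta>\<close>, and from \<open>F\<close> to \<open>H\<close> on multiplication by
          a nonnegative constant.\<close>
        define \<beta> where "\<beta> = real (k n) / real n * \<sigma> * \<tau> powr \<sigma> * u n powr (s - \<sigma>)"
        have "0 < \<beta>" using k n \<sigma> \<tau> u by (simp add: \<beta>_def)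
        have \<Psi>_hat: "\<Psi>_hat n \<omega> x = \<beta> * F x" if "x \<in> KJ" for x
          unfolding \<Psi>_hat_def \<beta>_def F_def
          using ssgen_objective[OF P_gen[OF n \<omega>] E(2)] that KJ(2) \<tau>(2) outside[OF that] u
          unfolding \<tau>_def \<sigma>_def by blast
        have "\<Psi>_hat n \<omega> y \<le> \<Psi>_hat n \<omega> z"
          using z zy(4) unfolding Y_hat_def by (rule argmax_setD(2))
        then have "F y \<le> F z" using \<Psi>_hat zy \<open>0 < \<beta>\<close> by simp
        then have "s * \<tau> powr s * p \<tau> * F y \<le> s * \<tau> powr s * p \<tau> * F z"
          using s by (intro mult_left_mono) (auto simp: p_def)
        then have "H y \<le> H z" by (simp add: H_def F_def mult_ac)
        moreover have "dist z y \<le> 2 * \<rho>\<^sub>1"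
          using norm_triangle_ineq4[of z y] \<rho>(4)[OF zy(1)] \<rho>(4)[OF zy(2)] by (simp add: dist_norm)
        ultimately have "infdist z (Y n) \<le> max 1 (2 * \<rho>\<^sub>1 / \<delta>\<^sub>0) * (2 * (B' * a') / c) powr (1 / \<kappa>)"
          using y zy close ident ident_constants unfolding Y_def
          by (intro argmax_stability[where H = H and KJ = KJ and \<Gamma> = "\<Gamma> n"]) auto
        also have "\<dots> \<le> max 1 (2 * \<rho>\<^sub>1 / \<delta>\<^sub>0) * (2 * (B' * a n \<omega>) / c) powr (1 / \<kappa>)"
          using a' B' ident_constants
          by (intro mult_left_mono powr_mono2 divide_right_mono) auto
        also have "(2 * (B' * a n \<omega>) / c) powr (1 / \<kappa>) = (2 * B' / c) powr (1 / \<kappa>) * a n \<omega> powr (1 / \<kappa>)"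
          using a' B' ident_constants by (simp add: powr_mult powr_divide)
        finally show ?thesis by (simp add: C_def mult.assoc)
      qed
      then show "(SUP z\<in>Y_hat n \<omega>. ennreal (infdist z (Y n))) \<le> ennreal (C * a n \<omega> powr (1 / \<kappa>))"
        by (intro SUP_least ennreal_leI)
    qed
    ultimately show "\<exists>C>0. \<forall>\<^sub>F n in sequentially. \<forall>\<omega>\<in>space M.
        T < t n \<omega> \<and> t n \<omega> \<le> \<eta> * u n \<and> Y_hat n \<omega> \<subseteq> KJ \<longrightarrow>
        ennreal \<bar>s_hat n \<omega> - s\<bar> \<le> ennreal (C\<^sub>1 * real (k n) powr - m) \<longrightarrow>
        angular_sup_norm E (\<lambda>\<theta>. \<phi>_hat n \<omega> \<theta> - cond_angular_density f (t n \<omega>) \<theta>)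
          \<le> ennreal (C\<^sub>2 * real (k n) powr - l) \<longrightarrow>
        (SUP z\<in>Y_hat n \<omega>. ennreal (infdist z (Y n))) \<le> ennreal (C * a n \<omega> powr (1 / \<kappa>))"
      by blast
  qed

  \<comment> \<open>The case of a unique maximizer\<close>
  fix z_star :: "nat \<Rightarrow> 'a" and z_hat :: "nat \<Rightarrow> 'w \<Rightarrow> 'a"
  assume single: "\<forall>\<^sub>F n in sequentially. Y n = {z_star n}"
    and z_hat: "with_prob_tending_to_one M (\<lambda>n \<omega>. z_hat n \<omega> \<in> Y_hat n \<omega>)"
  show "big_O_P M (\<lambda>n \<omega>. ennreal (norm (z_hat n \<omega> - z_star n))) (\<lambda>n \<omega>. a n \<omega> powr (1 / \<kappa>))"
  \<comment> \<open>The combination rule takes two stochastic orders, so \<open>main\<close> fills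
    both places. The distance to a singleton is the norm of the difference, which the supremum
    dominates.\<close>
  proof (rule big_O_P_combine[OF main main z_hat])
    fix C\<^sub>1 C\<^sub>2 :: real assume "0 < C\<^sub>1"
    have "\<forall>\<^sub>F n in sequentially. \<forall>\<omega>\<in>space M. z_hat n \<omega> \<in> Y_hat n \<omega> \<longrightarrow>
        (SUP z\<in>Y_hat n \<omega>. ennreal (infdist z (Y n))) \<le> ennreal (C\<^sub>1 * a n \<omega> powr (1 / \<kappa>)) \<longrightarrow>
        ennreal (norm (z_hat n \<omega> - z_star n)) \<le> ennreal (C\<^sub>1 * a n \<omega> powr (1 / \<kappa>))"
      using single
    proof (eventually_elim, intro ballI impI)
      fix n \<omega>
      assume "Y n = {z_star n}" "z_hat n \<omega> \<in> Y_hat n \<omega>"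
        and le: "(SUP z\<in>Y_hat n \<omega>. ennreal (infdist z (Y n))) \<le> ennreal (C\<^sub>1 * a n \<omega> powr (1 / \<kappa>))"
      then have "ennreal (norm (z_hat n \<omega> - z_star n)) \<le> (SUP z\<in>Y_hat n \<omega>. ennreal (infdist z (Y n)))"
        by (intro SUP_upper2[of "z_hat n \<omega>"]) (auto simp: dist_norm)
      then show "ennreal (norm (z_hat n \<omega> - z_star n)) \<le> ennreal (C\<^sub>1 * a n \<omega> powr (1 / \<kappa>))"
        using le by (rule order_trans)
    qed
    then show "\<exists>C>0. \<forall>\<^sub>F n in sequentially. \<forall>\<omega>\<in>space M. z_hat n \<omega> \<in> Y_hat n \<omega> \<longrightarrow>
        (SUP z\<in>Y_hat n \<omega>. ennreal (infdist z (Y n))) \<le> ennreal (C\<^sub>1 * a n \<omega> powr (1 / \<kappa>)) \<longrightarrow>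
        (SUP z\<in>Y_hat n \<omega>. ennreal (infdist z (Y n))) \<le> ennreal (C\<^sub>2 * a n \<omega> powr (1 / \<kappa>)) \<longrightarrow>
        ennreal (norm (z_hat n \<omega> - z_star n)) \<le> ennreal (C * a n \<omega> powr (1 / \<kappa>))"
      using \<open>0 < C\<^sub>1\<close> by (intro exI[of _ C\<^sub>1] conjI) (auto elim: eventually_mono)
  qed
qed

end
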